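(* Let $H,K$ be two infinite and finitely generated amenable groups. There exists an $H$-subshift which is effectively closed by patterns and whose free extension to $G=H\times K$ is not sofic.
   Context: Subshifts. For a group $G$ and a finite set $A$ (with the discrete topology), $A^G$ carries the product topology and the left shift action $(gx)(h)=x(g^{-1}h)$. A $G$-subshift is a closed $G$-invariant subset of $A^G$. A pattern is an element $p\in A^F$ with $F\subset G$ finite, and $[p]=\{x\in A^G: x|_F=p\}$. A set of patterns $\mathcal{F}$ defines the subshift $X_{\mathcal{F}}=\{x\in A^G: gx\notin[p]\text{ for all }g\in G,\ p\in\mathcal{F}\}$. A subshift is of finite type (SFT) if it equals $X_{\mathcal{F}}$ for a finite set $\mathcal{F}$. A subshift is sofic if it is the image of an SFT (over the same group $G$, possibly another finite alphabet) under a continuous $G$-equivariant surjective map. Effectively closed by patterns. Let $H$ be a finitely generated group with finite generating set $S$. For $w\in S^*$ let $\underline{w}\in H$ be the element represented by $w$. A pattern coding is a map $c\colon W\to A$ with $W\subset S^*$ finite; its cylinder is $[c]=\bigcap_{w\in W}\{x\in A^H: x(\underline{w})=c(w)\}$. A set $\mathcal{C}$ of pattern codings defines $X_{\mathcal{C}}=\{x\in A^H: hx\notin[c]\text{ for all }h\in H,\ c\in\mathcal{C}\}$. An $H$-subshift $X$ is effectively closed by patterns if $X=X_{\mathcal{C}}$ for some recursively enumerable set $\mathcal{C}$ of pattern codings. Free extension. The free extension of an $H$-subshift $X\subset A^H$ to $G=H\times K$ (with $H$ identified with $H\times\{1_K\}$) is the $G$-subshift $\widetilde{X}=\{\widetilde{x}\in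 A^{G}: \text{for every } g\in G,\ (\widetilde{x}(gh))_{h\in H}\in X\}$, i.e. the set of configurations such that for each $k\in K$ the map $h\mapsto \widetilde{x}(h,k)$ lies in $X$. *)

theory Defs
  imports
    "HOL-Analysis.Analysis"
    "HOL-Algebra.Generated_Groups"
    "HOL-Library.Nat_Bijection"
begin

section \<open>Groups\<close>

definition finitely_generated :: "('g, 'm) monoid_scheme \<Rightarrow> bool" where
  "finitely_generated G \<longleftrightarrow> (\<exists>S. finite S \<and> S \<subseteq> carrier G \<and> generate G S = carrier G)"

text \<open>Foelner's condition, for left translations.\<close>

definition amenable :: "('g, 'm) monoid_scheme \<Rightarrow> bool" where
  "amenable G \<longleftrightarrow>
     (\<forall>E \<epsilon>. finite E \<longrightarrow> E \<subseteq> carrier G \<longrightarrow> \<epsilon> > (0::real) \<longrightarrow>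
        (\<exists>F. finite F \<and> F \<noteq> {} \<and> F \<subseteq> carrier G \<and>
             (\<forall>g\<in>E. real (card (sym_diff (g <#\<^bsub>G\<^esub> F) F)) \<le> \<epsilon> * real (card F))))"

definition word_value :: "('g, 'm) monoid_scheme \<Rightarrow> 'g list \<Rightarrow> 'g" where
  "word_value G w = foldr (\<lambda>s g. s \<otimes>\<^bsub>G\<^esub> g) w \<one>\<^bsub>G\<^esub>"

text \<open>
  Pattern codings use words in \<open>S\<close> without formal inverses, so a generating set has to be
  understood in the sense that every group element is represented by such a word. This covers all
  finite symmetric generating sets, see \<open>finite_word_generating_symmetric\<close> below.
\<close>

definition finite_word_generating :: "('g, 'm) monoid_scheme \<Rightarrow> 'g set \<Rightarrow> bool" where
  "finite_word_generating G S \<longleftrightarrow>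
     finite S \<and> S \<subseteq> carrier G \<and> word_value G ` lists S = carrier G"

lemma (in group) word_value_closed:
  "w \<in> lists S \<Longrightarrow> S \<subseteq> carrier G \<Longrightarrow> word_value G w \<in> carrier G"
  by (induction w) (auto simp: word_value_def)

lemma (in group) word_value_append:
  "\<lbrakk>u \<in> lists S; w \<in> lists S; S \<subseteq> carrier G\<rbrakk>
     \<Longrightarrow> word_value G (u @ w) = word_value G u \<otimes> word_value G w"
proof (induction u)
  case Nil
  then show ?case using word_value_closed[of w S] by (simp add: word_value_def)
next
  case (Cons a u)
  then show ?case
    using word_value_closed[of w S] word_value_closed[of u S]
    by (auto simp: word_value_def m_assoc)
qed

lemma (in group) finite_word_generating_symmetric:
  assumes "finite S" "S \<subseteq> carrier G" "generate G S = carrier G" "\<And>s. s \<in> S \<Longrightarrow> inv s \<in> S"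
  shows "finite_word_generating G S"
proof -
  have "h \<in> word_value G ` lists S" if "h \<in> generate G S" for h
    using that
  proof (induction rule: generate.induct)
    case one
    have "word_value G [] = \<one>" by (simp add: word_value_def)
    then show ?case by (intro image_eqI[of _ _ "[]"]) auto
  next
    case (incl h)
    then have "word_value G [h] = h" "[h] \<in> lists S"
      using assms(2) by (auto simp: word_value_def)
    then show ?case by (intro image_eqI[of _ _ "[h]"]) auto
  next
    case (inv h)
    then have "word_value G [inv h] = inv h" "[inv h] \<in> lists S"
      using assms(2,4) by (auto simp: word_value_def)
    then show ?case by (intro image_eqI[of _ _ "[inv h]"]) auto
  next
    case (eng h1 h2)
    then obtain u w where "u \<in> lists S" "w \<in> lists S" "h1 = word_value G u" "h2 = word_value G w"
      by auto
    then have "word_value G (u @ w) = h1 \<otimes> h2" "u @ w \<in> lists S"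
      using assms(2) by (simp_all add: word_value_append[of u S w] append_in_lists_conv)
    then show ?case by (intro image_eqI[of _ _ "u @ w"]) auto
  qed
  then have "carrier G \<subseteq> word_value G ` lists S" using assms(3) by blast
  moreover have "word_value G ` lists S \<subseteq> carrier G"
    using word_value_closed[OF _ assms(2)] by (rule image_subsetI)
  ultimately show ?thesis
    using assms(1,2) unfolding finite_word_generating_def by (intro conjI equalityI)
qed

lemma (in group) finitely_generated_iff_finite_word_generating:
  "finitely_generated G \<longleftrightarrow> (\<exists>S. finite_word_generating G S)"
proof
  assume "finitely_generated G"
  then obtain S where S: "finite S" "S \<subseteq> carrier G" "generate G S = carrier G"
    by (auto simp: finitely_generated_def)
  let ?T = "S \<union> m_inv G ` S"
  have T: "?T \<subseteq> carrier G" using S(2) by auto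
  have "carrier G \<subseteq> generate G ?T" using mono_generate[of S ?T] S(3) by auto
  then have "generate G ?T = carrier G" using generate_incl[OF T] by auto
  moreover have "inv s \<in> ?T" if "s \<in> ?T" for s using that S(2) by auto
  ultimately show "\<exists>S. finite_word_generating G S"
    using finite_word_generating_symmetric[of ?T] S(1) T by (metis finite_UnI finite_imageI)
next
  assume "\<exists>S. finite_word_generating G S"
  then obtain S where S: "finite S" "S \<subseteq> carrier G" "word_value G ` lists S = carrier G"
    by (auto simp: finite_word_generating_def)
  have "word_value G w \<in> generate G S" if "w \<in> lists S" for w
    using that
  proof (induction w)
    case Nil
    then show ?case by (simp add: word_value_def generate.one)
  next
    case (Cons a w)
    then have "a \<otimes> word_value G w \<in> generate G S"
      by (auto intro: generate.eng[OF generate.incl[of a]])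
    then show ?case by (simp add: word_value_def)
  qed
  then have "carrier G \<subseteq> generate G S" unfolding S(3)[symmetric] by (rule image_subsetI)
  then have "generate G S = carrier G" using generate_incl[OF S(2)] by (intro equalityI)
  then show "finitely_generated G"
    unfolding finitely_generated_def using S(1,2) by (intro exI[of _ S] conjI)
qed


section \<open>Subshifts\<close>

text \<open>
  An element of \<open>A\<^sup>G\<close> is an extensional function on the carrier, i.e. an element of
  \<open>carrier G \<rightarrow>\<^sub>E A\<close>, which is the underlying set of the product topology.
\<close>

definition full_shift :: "('g, 'm) monoid_scheme \<Rightarrow> 'a set \<Rightarrow> ('g \<Rightarrow> 'a) topology" where
  "full_shift G A = product_topology (\<lambda>_. discrete_topology A) (carrier G)"

abbreviation configurations :: "('g, 'm) monoid_scheme \<Rightarrow> 'a set \<Rightarrow> ('g \<Rightarrow> 'a) set" where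
  "configurations G A \<equiv> carrier G \<rightarrow>\<^sub>E A"

definition shift :: "('g, 'm) monoid_scheme \<Rightarrow> 'g \<Rightarrow> ('g \<Rightarrow> 'a) \<Rightarrow> 'g \<Rightarrow> 'a" where
  "shift G g x = (\<lambda>h\<in>carrier G. x (inv\<^bsub>G\<^esub> g \<otimes>\<^bsub>G\<^esub> h))"

definition subshift :: "('g, 'm) monoid_scheme \<Rightarrow> 'a set \<Rightarrow> ('g \<Rightarrow> 'a) set \<Rightarrow> bool" where
  "subshift G A X \<longleftrightarrow>
     closedin (full_shift G A) X \<and> (\<forall>g\<in>carrier G. \<forall>x\<in>X. shift G g x \<in> X)"

text \<open>A pattern \<open>p \<in> A\<^sup>F\<close> is a finite partial map with domain \<open>F\<close>.\<close>

definition patterns :: "('g, 'm) monoid_scheme \<Rightarrow> 'a set \<Rightarrow> ('g \<rightharpoonup> 'a) set" where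
  "patterns G A = {p. finite (dom p) \<and> dom p \<subseteq> carrier G \<and> ran p \<subseteq> A}"

definition cylinder :: "('g, 'm) monoid_scheme \<Rightarrow> 'a set \<Rightarrow> ('g \<rightharpoonup> 'a) \<Rightarrow> ('g \<Rightarrow> 'a) set" where
  "cylinder G A p = {x \<in> configurations G A. \<forall>h\<in>dom p. p h = Some (x h)}"

definition subshift_of_patterns ::
    "('g, 'm) monoid_scheme \<Rightarrow> 'a set \<Rightarrow> ('g \<rightharpoonup> 'a) set \<Rightarrow> ('g \<Rightarrow> 'a) set" where
  "subshift_of_patterns G A P =
     {x \<in> configurations G A. \<forall>g\<in>carrier G. \<forall>p\<in>P. shift G g x \<notin> cylinder G A p}"

definition sft :: "('g, 'm) monoid_scheme \<Rightarrow> 'a set \<Rightarrow> ('g \<Rightarrow> 'a) set \<Rightarrow> bool" where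
  "sft G A X \<longleftrightarrow> (\<exists>P. finite P \<and> P \<subseteq> patterns G A \<and> X = subshift_of_patterns G A P)"

text \<open>
  The alphabet of the covering SFT ranges over the finite sets of natural numbers; up to renaming
  of symbols these are all finite alphabets.
\<close>

definition sofic :: "('g, 'm) monoid_scheme \<Rightarrow> 'a set \<Rightarrow> ('g \<Rightarrow> 'a) set \<Rightarrow> bool" where
  "sofic G A Y \<longleftrightarrow>
     (\<exists>(B :: nat set) X \<phi>.
        finite B \<and> sft G B X \<and>
        continuous_map (subtopology (full_shift G B) X) (subtopology (full_shift G A) Y) \<phi> \<and>
        (\<forall>g\<in>carrier G. \<forall>x\<in>X. \<phi> (shift G g x) = shift G g (\<phi> x)) \<and>
        \<phi> ` X = Y)"

definition free_extension ::
    "('h, 'm) monoid_scheme \<Rightarrow> ('k, 'n) monoid_scheme \<Rightarrow> 'a set \<Rightarrow>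
     ('h \<Rightarrow> 'a) set \<Rightarrow> ('h \<times> 'k \<Rightarrow> 'a) set" where
  "free_extension H K A X =
     {x \<in> configurations (H \<times>\<times> K) A.
        \<forall>g\<in>carrier (H \<times>\<times> K). (\<lambda>h\<in>carrier H. x (g \<otimes>\<^bsub>H \<times>\<times> K\<^esub> (h, \<one>\<^bsub>K\<^esub>))) \<in> X}"


section \<open>Recursively enumerable sets of natural numbers\<close>

datatype recf =
    Zero
  | Succ
  | Proj nat
  | Comp recf "recf list"
  | PrimRec recf recf
  | Mu recf

text \<open>
  \<open>computes f xs y\<close>: the partial recursive function with description \<open>f\<close> is defined at the
  argument tuple \<open>xs\<close> and has value \<open>y\<close> there.
\<close>

inductive computes :: "recf \<Rightarrow> nat list \<Rightarrow> nat \<Rightarrow> bool" where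
  "computes Zero xs 0"
| "computes Succ [n] (Suc n)"
| "i < length xs \<Longrightarrow> computes (Proj i) xs (xs ! i)"
| "list_all2 (\<lambda>g y. computes g xs y) gs ys \<Longrightarrow> computes f ys z \<Longrightarrow> computes (Comp f gs) xs z"
| "computes f xs y \<Longrightarrow> computes (PrimRec f g) (0 # xs) y"
| "computes (PrimRec f g) (n # xs) y \<Longrightarrow> computes g (n # y # xs) z
     \<Longrightarrow> computes (PrimRec f g) (Suc n # xs) z"
| "computes f (n # xs) 0 \<Longrightarrow> (\<forall>m<n. \<exists>y. computes f (m # xs) (Suc y)) \<Longrightarrow> computes (Mu f) xs n"

definition recursively_enumerable :: "nat set \<Rightarrow> bool" where
  "recursively_enumerable N \<longleftrightarrow> (\<exists>f. N = {n. \<exists>y. computes f [n] y})"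


section \<open>Effectively closed subshifts\<close>

definition pattern_codings :: "'g set \<Rightarrow> 'a set \<Rightarrow> ('g list \<rightharpoonup> 'a) set" where
  "pattern_codings S A = {c. finite (dom c) \<and> dom c \<subseteq> lists S \<and> ran c \<subseteq> A}"

definition coding_cylinder ::
    "('g, 'm) monoid_scheme \<Rightarrow> 'a set \<Rightarrow> ('g list \<rightharpoonup> 'a) \<Rightarrow> ('g \<Rightarrow> 'a) set" where
  "coding_cylinder G A c =
     {x \<in> configurations G A. \<forall>w\<in>dom c. c w = Some (x (word_value G w))}"

definition subshift_of_codings ::
    "('g, 'm) monoid_scheme \<Rightarrow> 'a set \<Rightarrow> ('g list \<rightharpoonup> 'a) set \<Rightarrow> ('g \<Rightarrow> 'a) set" where
  "subshift_of_codings G A C =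
     {x \<in> configurations G A. \<forall>g\<in>carrier G. \<forall>c\<in>C. shift G g x \<notin> coding_cylinder G A c}"

text \<open>
  The code of a pattern coding is that of its graph, a finite set of pairs of a word and a symbol;
  \<open>e\<close> numbers the letters.
\<close>

definition coding_code :: "('g \<Rightarrow> nat) \<Rightarrow> ('g list \<rightharpoonup> nat) \<Rightarrow> nat" where
  "coding_code e c =
     set_encode {prod_encode (list_encode (map e w), a) | w a. c w = Some a}"

text \<open>
  As \<open>S\<close> is finite, any two numberings of \<open>S\<close> differ by a computable relabelling, so
  the choice of \<open>e\<close> is immaterial.
\<close>

definition recursively_enumerable_codings :: "'g set \<Rightarrow> ('g list \<rightharpoonup> nat) set \<Rightarrow> bool" where
  "recursively_enumerable_codings S C \<longleftrightarrow>
     (\<exists>e. inj_on e S \<and> recursively_enumerable (coding_code e ` C))"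

definition effectively_closed_by_patterns ::
    "('g, 'm) monoid_scheme \<Rightarrow> 'g set \<Rightarrow> nat set \<Rightarrow> ('g \<Rightarrow> nat) set \<Rightarrow> bool" where
  "effectively_closed_by_patterns G S A X \<longleftrightarrow>
     subshift G A X \<and>
     (\<exists>C \<subseteq> pattern_codings S A.
        recursively_enumerable_codings S C \<and> X = subshift_of_codings G A C)"

end

theory Submission
  imports Defs
begin

text \<open>
  Consider the subshift over \<open>H\<close> on the symbols \<open>0, \<dots>, 4\<close> with the following rule: whenever \<open>g\<close> carries
  the source mark \<open>3\<close> and \<open>h\<close> the target mark \<open>4\<close>, no \<open>v\<close> has the symbol \<open>1\<close> at \<open>g v\<close> and the symbol \<open>2\<close> at
  \<open>h v\<close>. Writing \<open>h = g w\<close>, this is a rule on the words that represent \<open>w\<close> and \<open>v\<close>. The forbidden codings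
  can be listed by an algorithm that knows nothing about the group, so the subshift is effectively
  closed by patterns (\<open>recursively_enumerable_clashes\<close>).

  The marks transport an arbitrary amount of information over an arbitrary distance. Let \<open>F\<close> be a
  finite subset of \<open>H\<close>. As \<open>H\<close> is infinite, there is a translate \<open>t F\<close> disjoint from \<open>F\<close>, and a
  configuration can show any subset \<open>Q\<close> of \<open>F\<close> by symbols \<open>1\<close> on \<open>F\<close> and its complement by symbols \<open>2\<close> on
  \<open>t F\<close>, with marks at \<open>a\<close> and \<open>t a\<close>. Replacing the contents of \<open>F\<close> by those for another subset \<open>Q'\<close> breaks
  the rule in one of the two directions (\<open>override_transported_notin\<close>). So \<open>F\<close> has \<open>2 ^ card F\<close> contents
  that the outside tells apart, and in the free extension a box \<open>F \<times> F'\<close> has \<open>2 ^ card (F \<times> F')\<close>, since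
  the slices are independent.

  In a sofic subshift, however, all information between \<open>W\<close> and its complement passes through the boundary
  of \<open>W\<close> in the covering subshift of finite type: among more than \<open>2 ^ (m * card (boundary D W))\<close> points
  there are two whose contents on \<open>W\<close> can be exchanged, for some \<open>D\<close> and \<open>m\<close> independent of \<open>W\<close>
  (\<open>sofic_exchange\<close>). As \<open>H\<close> and \<open>K\<close> are amenable, there are boxes whose boundary is arbitrarily small
  compared to their size (\<open>amenable_right_invariant_product\<close>), and these two facts contradict each other.
\<close>

section \<open>Total recursive functions\<close>

text \<open>
  Working with total functions makes \<open>computes f xs y\<close> equivalent to an equation, so that every
  closure property below is a statement about values. One direction of it says that the value is
  computed, the other that it is the only one.
\<close>

definition recursive :: "nat \<Rightarrow> (nat list \<Rightarrow> nat) \<Rightarrow> bool" where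
  "recursive k \<phi> \<longleftrightarrow> (\<exists>f. \<forall>xs y. length xs = k \<longrightarrow> (computes f xs y \<longleftrightarrow> y = \<phi> xs))"

inductive_cases computes_ZeroE: "computes Zero xs y"
inductive_cases computes_SuccE: "computes Succ xs y"
inductive_cases computes_ProjE: "computes (Proj i) xs y"
inductive_cases computes_CompE: "computes (Comp f gs) xs y"
inductive_cases computes_PrimRec_0E: "computes (PrimRec f g) (0 # xs) y"
inductive_cases computes_PrimRec_SucE: "computes (PrimRec f g) (Suc n # xs) y"
inductive_cases computes_MuE: "computes (Mu f) xs y"

lemma recursive_zero: "recursive k (\<lambda>_. 0)"
  unfolding recursive_def
  by (rule exI[of _ Zero]) (auto intro: computes.intros elim: computes_ZeroE)

lemma recursive_nth: "i < k \<Longrightarrow> recursive k (\<lambda>xs. xs ! i)"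
  unfolding recursive_def
  by (rule exI[of _ "Proj i"]) (auto intro: computes.intros elim: computes_ProjE)

lemma recursive_Comp:
  assumes h: "recursive (length \<phi>s) h" and \<phi>s: "\<And>\<phi>. \<phi> \<in> set \<phi>s \<Longrightarrow> recursive k \<phi>"
  shows "recursive k (\<lambda>xs. h (map (\<lambda>\<phi>. \<phi> xs) \<phi>s))"
proof -
  obtain f where f: "\<And>xs y. length xs = length \<phi>s \<Longrightarrow> computes f xs y \<longleftrightarrow> y = h xs"
    using h unfolding recursive_def by blast
  have "\<forall>\<phi>. \<exists>g. \<phi> \<in> set \<phi>s \<longrightarrow> (\<forall>xs y. length xs = k \<longrightarrow> (computes g xs y \<longleftrightarrow> y = \<phi> xs))"
    using \<phi>s unfolding recursive_def by blast
  then obtain p where p: "\<And>\<phi> xs y. \<phi> \<in> set \<phi>s \<Longrightarrow> length xs = k \<Longrightarrow>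
      computes (p \<phi>) xs y \<longleftrightarrow> y = \<phi> xs"
    by metis
  have args: "list_all2 (\<lambda>g y. computes g xs y) (map p \<phi>s) ys \<longleftrightarrow> ys = map (\<lambda>\<phi>. \<phi> xs) \<phi>s"
    if "length xs = k" for xs ys
    using p that by (auto simp: list_all2_conv_all_nth intro!: nth_equalityI)
  have "computes (Comp f (map p \<phi>s)) xs y \<longleftrightarrow> y = h (map (\<lambda>\<phi>. \<phi> xs) \<phi>s)"
    if "length xs = k" for xs y
  proof
    assume "computes (Comp f (map p \<phi>s)) xs y"
    then show "y = h (map (\<lambda>\<phi>. \<phi> xs) \<phi>s)"
      by (rule computes_CompE) (simp add: args[OF that] f)
  next
    assume "y = h (map (\<lambda>\<phi>. \<phi> xs) \<phi>s)"
    then have "computes f (map (\<lambda>\<phi>. \<phi> xs) \<phi>s) y" using f by simp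
    then show "computes (Comp f (map p \<phi>s)) xs y"
      by (rule computes.intros(4)[rotated]) (simp add: args[OF that])
  qed
  then show ?thesis unfolding recursive_def by blast
qed

lemma recursive_cong:
  "recursive k \<phi> \<Longrightarrow> (\<And>xs. length xs = k \<Longrightarrow> \<phi> xs = \<psi> xs) \<Longrightarrow> recursive k \<psi>"
  unfolding recursive_def by metis

lemma recursive_Suc:
  assumes "recursive k \<phi>"
  shows "recursive k (\<lambda>xs. Suc (\<phi> xs))"
proof -
  have "recursive 1 (\<lambda>xs. Suc (hd xs))"
    unfolding recursive_def
    by (rule exI[of _ Succ])
      (auto simp: length_Suc_conv intro: computes.intros elim: computes_SuccE)
  then show ?thesis using recursive_Comp[of "[\<phi>]" "\<lambda>xs. Suc (hd xs)" k] assms by simp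
qed

text \<open>
  The step function of a primitive recursion receives the counter and the previous value in front of
  the parameters; this turns functions of the parameters alone into functions of all of these.
\<close>

lemma recursive_drop:
  assumes "recursive k \<phi>"
  shows "recursive (Suc (Suc k)) (\<lambda>xs. \<phi> (drop 2 xs))"
proof -
  have "recursive (Suc (Suc k))
      (\<lambda>xs. \<phi> (map (\<lambda>\<psi>. \<psi> xs) (map (\<lambda>i xs. xs ! (i + 2)) [0..<k])))"
    by (rule recursive_Comp) (use assms in \<open>auto intro: recursive_nth\<close>)
  then show ?thesis
    by (rule recursive_cong) (auto intro!: arg_cong[of _ _ \<phi>] nth_equalityI simp: add.commute)
qed

text \<open>
  The conclusion is a higher-order pattern, so that a function is shown to be recursive by writing it
  with \<^const>\<open>rec_nat\<close> and applying the closure rules backwards.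
\<close>

lemma recursive_rec_nat:
  assumes b: "recursive k b"
    and st: "recursive (Suc (Suc k)) (\<lambda>xs. st (xs ! 0) (xs ! 1) (drop 2 xs))"
    and \<nu>: "recursive k \<nu>"
  shows "recursive k (\<lambda>xs. rec_nat (b xs) (\<lambda>i y. st i y xs) (\<nu> xs))"
proof -
  obtain f where f: "\<And>xs y. length xs = k \<Longrightarrow> computes f xs y \<longleftrightarrow> y = b xs"
    using b unfolding recursive_def by blast
  obtain g where g: "\<And>xs y. length xs = Suc (Suc k) \<Longrightarrow>
      computes g xs y \<longleftrightarrow> y = st (xs ! 0) (xs ! 1) (drop 2 xs)"
    using st unfolding recursive_def by blast
  have "computes (PrimRec f g) (n # xs) y \<longleftrightarrow> y = rec_nat (b xs) (\<lambda>i y. st i y xs) n"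
    if "length xs = k" for n xs y
  proof (induction n arbitrary: y)
    case 0
    then show ?case using f[OF that] by (auto intro: computes.intros elim: computes_PrimRec_0E)
  next
    case (Suc n)
    have "computes g (n # r # xs) z \<longleftrightarrow> z = st n r xs" for r z
      using g[of "n # r # xs" z] that by simp
    then show ?case
      using Suc by (auto intro: computes.intros(6) elim!: computes_PrimRec_SucE)
  qed
  then have "computes (PrimRec f g) xs y \<longleftrightarrow>
      y = rec_nat (b (tl xs)) (\<lambda>i y. st i y (tl xs)) (hd xs)" if "length xs = Suc k" for xs y
    using that by (cases xs) auto
  then have "recursive (Suc k) (\<lambda>xs. rec_nat (b (tl xs)) (\<lambda>i y. st i y (tl xs)) (hd xs))"
    unfolding recursive_def by blast
  then have "recursive (length (\<nu> # map (\<lambda>i xs. xs ! i) [0..<k]))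
      (\<lambda>xs. rec_nat (b (tl xs)) (\<lambda>i y. st i y (tl xs)) (hd xs))"
    by simp
  from recursive_Comp[OF this, of k]
  have "recursive k (\<lambda>xs. rec_nat (b (map (\<lambda>i. xs ! i) [0..<k]))
      (\<lambda>i y. st i y (map (\<lambda>i. xs ! i) [0..<k])) (\<nu> xs))"
    using \<nu> by (simp add: comp_def) (metis (no_types, lifting) atLeastLessThan_iff imageE recursive_nth)
  then show ?thesis
    by (rule recursive_cong) (metis map_nth)
qed

lemma recursive_const: "recursive k (\<lambda>_. c)"
  by (induction c) (auto intro: recursive_zero recursive_Suc)

lemma recursive_add:
  assumes "recursive k \<phi>" "recursive k \<psi>"
  shows "recursive k (\<lambda>xs. \<phi> xs + \<psi> xs)"
proof -
  have eq: "rec_nat x (\<lambda>_. Suc) y = x + y" for x y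
    by (induction y) auto
  have "recursive k (\<lambda>xs. rec_nat (\<phi> xs) (\<lambda>_. Suc) (\<psi> xs))"
    by (intro recursive_rec_nat recursive_Suc recursive_nth assms) simp_all
  then show ?thesis by (simp only: eq)
qed

lemma recursive_pred:
  assumes "recursive k \<phi>"
  shows "recursive k (\<lambda>xs. \<phi> xs - 1)"
proof -
  have eq: "rec_nat 0 (\<lambda>i _. i) x = x - 1" for x
    by (cases x) auto
  have "recursive k (\<lambda>xs. rec_nat 0 (\<lambda>i _. i) (\<phi> xs))"
    by (intro recursive_rec_nat recursive_zero recursive_nth assms) simp_all
  then show ?thesis by (simp only: eq)
qed

lemma recursive_diff:
  assumes "recursive k \<phi>" "recursive k \<psi>"
  shows "recursive k (\<lambda>xs. \<phi> xs - \<psi> xs)"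
proof -
  have eq: "rec_nat x (\<lambda>_ z. z - 1) y = x - y" for x y :: nat
    by (induction y) auto
  have "recursive k (\<lambda>xs. rec_nat (\<phi> xs) (\<lambda>_ z. z - 1) (\<psi> xs))"
    by (intro recursive_rec_nat recursive_pred recursive_nth assms) simp_all
  then show ?thesis by (simp only: eq)
qed

lemma recursive_power2:
  assumes "recursive k \<phi>"
  shows "recursive k (\<lambda>xs. 2 ^ \<phi> xs)"
proof -
  have eq: "rec_nat 1 (\<lambda>_ y. y + y) x = (2 :: nat) ^ x" for x
    by (induction x) auto
  have "recursive k (\<lambda>xs. rec_nat 1 (\<lambda>_ y. y + y) (\<phi> xs))"
    by (intro recursive_rec_nat recursive_add recursive_const recursive_nth assms) simp_all
  then show ?thesis by (simp only: eq)
qed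

lemma recursive_triangle:
  assumes "recursive k \<phi>"
  shows "recursive k (\<lambda>xs. triangle (\<phi> xs))"
proof -
  have eq: "rec_nat 0 (\<lambda>i y. y + Suc i) x = triangle x" for x
    by (induction x) auto
  have "recursive k (\<lambda>xs. rec_nat 0 (\<lambda>i y. y + Suc i) (\<phi> xs))"
    by (intro recursive_rec_nat recursive_zero recursive_add recursive_Suc recursive_nth assms) simp_all
  then show ?thesis by (simp only: eq)
qed

lemma recursive_prod_encode:
  "recursive k \<phi> \<Longrightarrow> recursive k \<psi> \<Longrightarrow> recursive k (\<lambda>xs. prod_encode (\<phi> xs, \<psi> xs))"
  by (simp add: prod_encode_def recursive_add recursive_triangle)

text \<open>
  The inverse of \<^const>\<open>prod_encode\<close> by primitive recursion: \<open>prod_encode (a, b) = triangle (a + b) + a\<close>,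
  and the largest \<open>k\<close> with \<open>triangle k \<le> m\<close> grows by one exactly when \<open>m\<close> reaches the next
  triangular number. The factor \<open>1 - (x - y)\<close> is the truth value of \<open>x \<le> y\<close>.
\<close>

definition triangle_root :: "nat \<Rightarrow> nat" where
  "triangle_root m = rec_nat 0 (\<lambda>i y. y + (1 - (triangle (Suc y) - Suc i))) m"

lemma triangle_root_bounds:
  "triangle (triangle_root m) \<le> m \<and> m < triangle (Suc (triangle_root m))"
proof (induction m)
  case 0
  then show ?case by (simp add: triangle_root_def)
next
  case (Suc m)
  have step: "triangle_root (Suc m) =
      triangle_root m + (1 - (triangle (Suc (triangle_root m)) - Suc m))"
    by (simp add: triangle_root_def)
  show ?case
  proof (cases "triangle (Suc (triangle_root m)) \<le> Suc m")
    case True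
    then have "triangle_root (Suc m) = Suc (triangle_root m)" using step by simp
    then show ?thesis using Suc True by simp
  next
    case False
    then have "triangle_root (Suc m) = triangle_root m" using step by simp
    then show ?thesis using Suc False by simp
  qed
qed

lemma triangle_root_eq:
  assumes "a \<le> k"
  shows "triangle_root (triangle k + a) = k"
proof -
  let ?r = "triangle_root (triangle k + a)"
  have mono: "i \<le> j \<Longrightarrow> triangle i \<le> triangle j" for i j
    by (induction rule: dec_induct) auto
  have "\<not> ?r < k"
    using mono[of "Suc ?r" k] triangle_root_bounds[of "triangle k + a"] by linarith
  moreover have "\<not> k < ?r"
    using mono[of "Suc k" ?r] triangle_root_bounds[of "triangle k + a"] assms by auto
  ultimately show ?thesis by simp
qed

lemma recursive_triangle_root:
  assumes "recursive k \<phi>"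
  shows "recursive k (\<lambda>xs. triangle_root (\<phi> xs))"
  unfolding triangle_root_def
  by (intro recursive_rec_nat recursive_add recursive_diff recursive_triangle recursive_Suc
      recursive_const recursive_nth assms) simp_all

definition unpair1 :: "nat \<Rightarrow> nat" where
  "unpair1 m = m - triangle (triangle_root m)"

definition unpair2 :: "nat \<Rightarrow> nat" where
  "unpair2 m = triangle_root m - unpair1 m"

lemma unpair1_prod_encode [simp]: "unpair1 (prod_encode (a, b)) = a"
  by (simp add: unpair1_def prod_encode_def triangle_root_eq)

lemma unpair2_prod_encode [simp]: "unpair2 (prod_encode (a, b)) = b"
  by (simp add: unpair2_def) (simp add: prod_encode_def triangle_root_eq)

lemma recursive_unpair1: "recursive k \<phi> \<Longrightarrow> recursive k (\<lambda>xs. unpair1 (\<phi> xs))"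
  unfolding unpair1_def by (intro recursive_diff recursive_triangle recursive_triangle_root)

lemma recursive_unpair2: "recursive k \<phi> \<Longrightarrow> recursive k (\<lambda>xs. unpair2 (\<phi> xs))"
  unfolding unpair2_def by (intro recursive_diff recursive_unpair1 recursive_triangle_root)

text \<open>
  A total search for \<open>g m = n\<close> halts exactly on the range of \<open>g\<close>. Thus a set is shown to be
  recursively enumerable by listing its elements.
\<close>

lemma recursively_enumerable_range:
  assumes "recursive 1 (\<lambda>xs. g (xs ! 0))"
  shows "recursively_enumerable (range g)"
proof -
  have "recursive 2 (\<lambda>xs. g (map (\<lambda>\<phi>. \<phi> xs) [\<lambda>xs. xs ! 0] ! 0))"
    by (rule recursive_Comp) (use assms in \<open>auto intro: recursive_nth\<close>)
  \<comment> \<open>The sum of the two truncated differences is the distance of the two numbers.\<close>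
  then have "recursive 2 (\<lambda>xs. (g (xs ! 0) - xs ! 1) + (xs ! 1 - g (xs ! 0)))"
    by (intro recursive_add recursive_diff recursive_nth) auto
  then obtain f where f: "\<And>xs y. length xs = 2 \<Longrightarrow>
      computes f xs y \<longleftrightarrow> y = (g (xs ! 0) - xs ! 1) + (xs ! 1 - g (xs ! 0))"
    unfolding recursive_def by blast
  have f2: "computes f [m, n] y \<longleftrightarrow> y = (g m - n) + (n - g m)" for m n y
    using f[of "[m, n]" y] by simp
  have "n \<in> range g \<longleftrightarrow> (\<exists>y. computes (Mu f) [n] y)" for n
  proof
    assume "n \<in> range g"
    then have ex: "\<exists>m. g m = n" by auto
    define m where "m = (LEAST m. g m = n)"
    have "g m = n" unfolding m_def using ex by (rule LeastI_ex)
    moreover have "g i \<noteq> n" if "i < m" for i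
      using not_less_Least that unfolding m_def by blast
    moreover have "\<exists>y. Suc y = (g i - n) + (n - g i)" if "g i \<noteq> n" for i
      using that by (intro exI[of _ "(g i - n) + (n - g i) - 1"]) linarith
    ultimately have "computes (Mu f) [n] m"
      by (intro computes.intros(7)) (auto simp: f2)
    then show "\<exists>y. computes (Mu f) [n] y" by blast
  next
    assume "\<exists>y. computes (Mu f) [n] y"
    then obtain y where "computes f [y, n] 0" by (auto elim: computes_MuE)
    then have "g y = n" by (simp add: f2)
    then show "n \<in> range g" by auto
  qed
  then have "range g = {n. \<exists>y. computes (Mu f) [n] y}" by auto
  then show ?thesis unfolding recursively_enumerable_def by (rule exI)
qed

text \<open>
  A number \<open>m\<close> is read as a stream of digits by iterated unpairing, and each digit is cut off at \<open>b\<close>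
  so that every number gives words over the letters \<open>{..b}\<close>. The list code is built by putting the
  digits in front of a given list code; starting from the code of a word \<open>v\<close> instead of \<open>0\<close> gives
  concatenation with \<open>v\<close>. The digits come out reversed, as the last one read is put in front.
\<close>

definition rest :: "nat \<Rightarrow> nat \<Rightarrow> nat" where
  "rest i m = rec_nat m (\<lambda>_ y. unpair2 y) i"

definition digit :: "nat \<Rightarrow> nat \<Rightarrow> nat \<Rightarrow> nat" where
  "digit b i m = unpair1 (rest i m) - (unpair1 (rest i m) - b)"

definition word_onto :: "nat \<Rightarrow> nat \<Rightarrow> nat \<Rightarrow> nat \<Rightarrow> nat" where
  "word_onto b n m l = rec_nat l (\<lambda>i y. Suc (prod_encode (digit b i m, y))) n"

lemma word_onto_eq:
  "word_onto b n m (list_encode v) = list_encode (rev (map (\<lambda>i. digit b i m) [0..<n]) @ v)"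
  by (induction n) (simp_all add: word_onto_def)

lemma digit_le: "digit b i m \<le> b"
  by (simp add: digit_def)

lemma ex_digits:
  assumes "set ds \<subseteq> {..b}"
  shows "\<exists>m. ds = rev (map (\<lambda>i. digit b i m) [0..<length ds])"
proof -
  define enc where "enc = (\<lambda>ds. foldr (\<lambda>d y. prod_encode (d, y)) ds 0)"
  have rest: "i \<le> length ds \<Longrightarrow> rest i (enc ds) = enc (drop i ds)" for i ds
  proof (induction i)
    case 0
    show ?case by (simp add: rest_def)
  next
    case (Suc i)
    have "rest (Suc i) (enc ds) = unpair2 (rest i (enc ds))"
      by (simp add: rest_def)
    also have "\<dots> = unpair2 (enc (ds ! i # drop (Suc i) ds))"
      using Suc by (metis Cons_nth_drop_Suc Suc_leD Suc_le_lessD)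
    also have "\<dots> = enc (drop (Suc i) ds)" by (simp add: enc_def)
    finally show ?case .
  qed
  have digit_enc: "digit b i (enc ds) = ds ! i" if "set ds \<subseteq> {..b}" "i < length ds" for i ds
  proof -
    have "rest i (enc ds) = enc (ds ! i # drop (Suc i) ds)"
      using rest[of i ds] that(2) by (metis Cons_nth_drop_Suc less_imp_le)
    then have "unpair1 (rest i (enc ds)) = ds ! i" by (simp add: enc_def)
    moreover have "ds ! i \<le> b" using that nth_mem by blast
    ultimately show ?thesis by (simp add: digit_def)
  qed
  have digits: "digit b i (enc (rev ds)) = rev ds ! i" if "i < length ds" for i
    by (rule digit_enc) (use assms that in simp_all)
  have "map (\<lambda>i. digit b i (enc (rev ds))) [0..<length ds] = rev ds"
    by (rule nth_equalityI) (simp_all add: digits)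
  then have "ds = rev (map (\<lambda>i. digit b i (enc (rev ds))) [0..<length ds])" by simp
  then show ?thesis by (rule exI)
qed

lemma recursive_word_onto:
  assumes "recursive k \<nu>" "recursive k \<mu>" "recursive k \<rho>"
  shows "recursive k (\<lambda>xs. word_onto b (\<nu> xs) (\<mu> xs) (\<rho> xs))"
proof -
  have rest: "recursive j (\<lambda>xs. rest (\<phi> xs) (\<psi> xs))" if "recursive j \<phi>" "recursive j \<psi>" for j \<phi> \<psi>
    unfolding rest_def
    by (intro recursive_rec_nat recursive_unpair2 recursive_nth that) simp_all
  show ?thesis
    unfolding word_onto_def digit_def
    by (intro recursive_rec_nat recursive_Suc recursive_prod_encode recursive_diff recursive_unpair1
        rest recursive_const recursive_nth recursive_drop[OF assms(2)] assms) simp_all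
qed

section \<open>A recursively enumerable set of pattern codings\<close>

text \<open>
  Read from a position \<open>g\<close>, the coding says: \<open>g\<close> carries the source mark \<open>3\<close>, the position \<open>g w\<close> carries
  the target mark \<open>4\<close>, and the symbol \<open>1\<close> at \<open>g u\<close> meets the symbol \<open>2\<close> at the corresponding position
  \<open>g w u\<close> relative to the target. The symbols \<open>1\<close> and \<open>2\<close> mean \<^emph>\<open>dot\<close> and \<^emph>\<open>no dot at the
  source\<close>, and \<open>0\<close> means nothing.
\<close>

definition clash :: "'g list \<Rightarrow> 'g list \<Rightarrow> ('g list \<rightharpoonup> nat)" where
  "clash w u = [[] \<mapsto> 3, w \<mapsto> 4, u \<mapsto> 1, w @ u \<mapsto> 2]"

text \<open>
  The lengths of \<open>[]\<close>, \<open>w\<close>, \<open>u\<close>, \<open>w @ u\<close> are strictly increasing. So the four words are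
  distinct, whatever relations hold in the group, and the coding is a function. No group element is
  lost, since each is represented by arbitrarily long words.
\<close>

definition clashes :: "'g set \<Rightarrow> ('g list \<rightharpoonup> nat) set" where
  "clashes S = {clash w u | w u. w \<in> lists S \<and> u \<in> lists S \<and> w \<noteq> [] \<and> length w < length u}"

lemma clash_matches_iff:
  assumes "w \<noteq> []" "length w < length u"
  shows "(\<forall>v\<in>dom (clash w u). clash w u v = Some (f v)) \<longleftrightarrow>
    f [] = 3 \<and> f w = 4 \<and> f u = 1 \<and> f (w @ u) = 2"
  using assms by (auto simp: clash_def)

lemma clashes_subset: "clashes S \<subseteq> pattern_codings S {..<5}"
  by (auto simp: clashes_def clash_def pattern_codings_def ran_def split: if_splits)

text \<open>
  The four entries have different codes, so the set code is a plain sum, which is a recursive function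
  of the codes of the words.
\<close>

lemma coding_code_clash:
  assumes "w \<noteq> []" "length w < length u"
  shows "coding_code e (clash w u) =
    2 ^ prod_encode (0, 3) + 2 ^ prod_encode (list_encode (map e w), 4) +
    2 ^ prod_encode (list_encode (map e u), 1) + 2 ^ prod_encode (list_encode (map e (w @ u)), 2)"
proof -
  let ?p = "\<lambda>v a. prod_encode (list_encode (map e v), a)"
  have "{?p v a | v a. clash w u v = Some a} = {?p [] 3, ?p w 4, ?p u 1, ?p (w @ u) 2}"
  proof -
    have "{?p v a | v a. clash w u v = Some a} =
        (\<lambda>(v, a). ?p v a) ` {(v, a). clash w u v = Some a}"
      by auto
    also have "{(v, a). clash w u v = Some a} = {([], 3), (w, 4), (u, 1), (w @ u, 2)}"
      using assms by (auto simp: clash_def split: if_splits)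
    finally show ?thesis by simp
  qed
  moreover have "map e v \<noteq> map e v'" if "length v \<noteq> length v'" for v v'
    using that by (metis length_map)
  ultimately show ?thesis
    using assms unfolding coding_code_def set_encode_def
    by (simp add: prod_encode_eq list_encode_eq del: map_append map_eq_conv)
qed

text \<open>
  Number the letters by an initial segment of the naturals. Then four numbers, the lengths of the two
  words and their digit streams, enumerate all clashes. This is a matter of words alone: two words for
  the same group element are treated as different.
\<close>

lemma recursively_enumerable_clashes:
  assumes "finite S" "S \<noteq> {}"
  shows "recursively_enumerable_codings S (clashes S)"
proof -
  define b where "b = card S - 1"
  obtain e where "bij_betw e S {0..<card S}"
    using ex_bij_betw_finite_nat assms(1) by blast
  moreover have "{0..<card S} = {..b}"
  proof -
    have "card S > 0" using assms by (simp add: card_gt_0_iff)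
    then show ?thesis unfolding b_def by auto
  qed
  ultimately have e: "inj_on e S" "e ` S = {..b}" by (auto simp: bij_betw_def)
  define digits where "digits = (\<lambda>n m. rev (map (\<lambda>i. digit b i m) [0..<n]))"
  have length_digits [simp]: "length (digits n m) = n" for n m
    by (simp add: digits_def)
  have digits_word: "\<exists>w\<in>lists S. map e w = digits n m" for n m
  proof (rule bexI)
    have ds: "set (digits n m) \<subseteq> e ` S"
      unfolding e(2) by (auto simp: digits_def digit_le)
    then show "map e (map (inv_into S e) (digits n m)) = digits n m"
      by (auto simp: f_inv_into_f intro!: map_idI)
    show "map (inv_into S e) (digits n m) \<in> lists S"
      using ds inv_into_into[of _ e S] by (fastforce simp: in_lists_conv_set)
  qed
  have word_digits: "\<exists>m. map e w = digits (length w) m" if "w \<in> lists S" for w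
  proof -
    have "set (map e w) \<subseteq> {..b}" using that e(2) by auto
    then show ?thesis using ex_digits[of "map e w" b] by (simp add: digits_def)
  qed
  \<comment> \<open>The lengths are \<open>n + 1\<close> and \<open>n + i + 2\<close>, which are all pairs with \<open>0 < length w < length u\<close>.\<close>
  define code where "code = (\<lambda>n m i j. 2 ^ prod_encode (0, 3) +
    2 ^ prod_encode (word_onto b (Suc n) m 0, 4) +
    2 ^ prod_encode (word_onto b (Suc (Suc (n + i))) j 0, 1) +
    2 ^ prod_encode (word_onto b (Suc n) m (word_onto b (Suc (Suc (n + i))) j 0), 2) :: nat)"
  have word_onto_0: "word_onto b n m 0 = list_encode (digits n m)" for n m
    using word_onto_eq[of b n m "[]"] by (simp add: digits_def)
  have word_onto_list: "word_onto b n m (list_encode v) = list_encode (digits n m @ v)" for n m v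
    by (simp add: word_onto_eq digits_def)
  have code: "code n m i j = coding_code e (clash w u)"
    if "map e w = digits (Suc n) m" "map e u = digits (Suc (Suc (n + i))) j" for n m i j w u
  proof -
    have "length w = Suc n" "length u = Suc (Suc (n + i))"
      using that by (metis length_digits length_map)+
    then have "w \<noteq> []" "length w < length u" by auto
    then show ?thesis
      using that unfolding code_def word_onto_0 word_onto_list by (simp add: coding_code_clash)
  qed
  define g where "g = (\<lambda>t. code (unpair1 t) (unpair1 (unpair2 t))
    (unpair1 (unpair2 (unpair2 t))) (unpair2 (unpair2 (unpair2 t))))"
  have "coding_code e ` clashes S = range g"
  proof (intro equalityI subsetI)
    fix x assume "x \<in> coding_code e ` clashes S"
    then obtain w u where x: "x = coding_code e (clash w u)"
      and wu: "w \<in> lists S" "u \<in> lists S" "w \<noteq> []" "length w < length u"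
      unfolding clashes_def by auto
    obtain n where n: "length w = Suc n" using wu(3) by (cases w) auto
    then obtain i where i: "length u = Suc (Suc (n + i))"
      using wu(4) less_iff_Suc_add by auto
    obtain m j where "map e w = digits (Suc n) m" "map e u = digits (Suc (Suc (n + i))) j"
      using word_digits wu(1,2) n i by metis
    then have "x = g (prod_encode (n, prod_encode (m, prod_encode (i, j))))"
      by (simp add: g_def x code)
    then show "x \<in> range g" by simp
  next
    fix x assume "x \<in> range g"
    then obtain n m i j where x: "x = code n m i j" unfolding g_def by auto
    obtain w u where w: "w \<in> lists S" "map e w = digits (Suc n) m"
      and u: "u \<in> lists S" "map e u = digits (Suc (Suc (n + i))) j"
      using digits_word by metis
    have "length w = Suc n" "length u = Suc (Suc (n + i))"
      using w(2) u(2) by (metis length_digits length_map)+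
    then have "clash w u \<in> clashes S"
      using w(1) u(1) unfolding clashes_def by fastforce
    then show "x \<in> coding_code e ` clashes S"
      using code[OF w(2) u(2)] x by auto
  qed
  moreover have "recursive 1 (\<lambda>xs. g (xs ! 0))"
    unfolding g_def code_def
    by (intro recursive_add recursive_power2 recursive_prod_encode recursive_word_onto
        recursive_Suc recursive_unpair1 recursive_unpair2 recursive_const recursive_nth) simp_all
  ultimately show ?thesis
    using recursively_enumerable_range[of g] e(1)
    unfolding recursively_enumerable_codings_def by (intro exI[of _ e]) simp
qed

section \<open>Subshifts and their local rules\<close>

lemma topspace_full_shift [simp]: "topspace (full_shift G A) = configurations G A"
  by (simp add: full_shift_def)

lemma openin_full_shift_coordinate:
  assumes "h \<in> carrier G"
  shows "openin (full_shift G A) {x \<in> configurations G A. x h = a}"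
proof -
  have "continuous_map (full_shift G A) (discrete_topology A) (\<lambda>x. x h)"
    unfolding full_shift_def using assms by (rule continuous_map_product_projection)
  then have "openin (full_shift G A) {x \<in> topspace (full_shift G A). x h \<in> A \<inter> {a}}"
    by (rule openin_continuous_map_preimage) auto
  moreover have "{x \<in> topspace (full_shift G A). x h \<in> A \<inter> {a}} =
      {x \<in> configurations G A. x h = a}"
    using assms by auto
  ultimately show ?thesis by simp
qed

lemma openin_full_shift_agree:
  assumes "finite D" "\<And>d. d \<in> D \<Longrightarrow> \<tau> d \<in> carrier G"
  shows "openin (full_shift G A) {x \<in> configurations G A. \<forall>d\<in>D. x (\<tau> d) = v d}"
proof -
  have "openin (full_shift G A)
      ((\<Inter>d\<in>D. {x \<in> configurations G A. x (\<tau> d) = v d}) \<inter> topspace (full_shift G A))"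
    using assms by (intro openin_INT openin_full_shift_coordinate)
  moreover have "(\<Inter>d\<in>D. {x \<in> configurations G A. x (\<tau> d) = v d}) \<inter> topspace (full_shift G A) =
      {x \<in> configurations G A. \<forall>d\<in>D. x (\<tau> d) = v d}"
    by auto
  ultimately show ?thesis by simp
qed

text \<open>
  Common form of subshifts given by patterns and by codings: each forbidden occurrence constrains
  finitely many coordinates, so it is an open condition.
\<close>

lemma closedin_avoiding:
  assumes "\<And>p. p \<in> P \<Longrightarrow> finite (D p)"
    and "\<And>g p d. g \<in> carrier G \<Longrightarrow> p \<in> P \<Longrightarrow> d \<in> D p \<Longrightarrow> \<tau> g d \<in> carrier G"
  shows "closedin (full_shift G A)
    {x \<in> configurations G A. \<forall>g\<in>carrier G. \<forall>p\<in>P. \<not> (\<forall>d\<in>D p. x (\<tau> g d) = v p d)}"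
proof -
  let ?U = "\<Union>g\<in>carrier G. \<Union>p\<in>P. {x \<in> configurations G A. \<forall>d\<in>D p. x (\<tau> g d) = v p d}"
  have "openin (full_shift G A) ?U"
    using assms by (auto intro!: openin_Union openin_full_shift_agree)
  then have "closedin (full_shift G A) (topspace (full_shift G A) - ?U)"
    by (rule closedin_diff[OF closedin_topspace])
  moreover have "topspace (full_shift G A) - ?U =
      {x \<in> configurations G A. \<forall>g\<in>carrier G. \<forall>p\<in>P. \<not> (\<forall>d\<in>D p. x (\<tau> g d) = v p d)}"
    by (auto, blast)
  ultimately show ?thesis by simp
qed

context group
begin

lemma shift_apply: "h \<in> carrier G \<Longrightarrow> shift G g x h = x (inv g \<otimes> h)"
  by (simp add: shift_def)

lemma shift_configurations:
  "g \<in> carrier G \<Longrightarrow> x \<in> configurations G A \<Longrightarrow> shift G g x \<in> configurations G A"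
  by (auto simp: shift_def)

lemma shift_shift:
  assumes "g \<in> carrier G" "h \<in> carrier G"
  shows "shift G g (shift G h x) = shift G (g \<otimes> h) x"
  using assms by (auto simp: shift_def inv_mult_group m_assoc intro!: restrict_ext)

lemma shift_in_cylinder_iff:
  assumes "g \<in> carrier G" "x \<in> configurations G A" "p \<in> patterns G A"
  shows "shift G g x \<in> cylinder G A p \<longleftrightarrow> (\<forall>h\<in>dom p. x (inv g \<otimes> h) = the (p h))"
proof -
  have "p h = Some (shift G g x h) \<longleftrightarrow> x (inv g \<otimes> h) = the (p h)" if "h \<in> dom p" for h
    using that assms(3) by (auto simp: patterns_def shift_apply subset_iff)
  then show ?thesis
    using shift_configurations[OF assms(1,2)] by (simp add: cylinder_def)
qed

lemma shift_in_coding_cylinder_iff: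
  assumes "S \<subseteq> carrier G" "g \<in> carrier G" "x \<in> configurations G A" "c \<in> pattern_codings S A"
  shows "shift G g x \<in> coding_cylinder G A c \<longleftrightarrow>
    (\<forall>w\<in>dom c. x (inv g \<otimes> word_value G w) = the (c w))"
proof -
  have "word_value G w \<in> carrier G" if "w \<in> dom c" for w
    using that assms(1,4) word_value_closed[of w S] by (auto simp: pattern_codings_def)
  then have "c w = Some (shift G g x (word_value G w)) \<longleftrightarrow>
      x (inv g \<otimes> word_value G w) = the (c w)" if "w \<in> dom c" for w
    using that by (auto simp: shift_apply)
  then show ?thesis
    using shift_configurations[OF assms(2,3)] by (simp add: coding_cylinder_def)
qed

lemma closedin_subshift_of_patterns:
  assumes "P \<subseteq> patterns G A"
  shows "closedin (full_shift G A) (subshift_of_patterns G A P)"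
proof -
  have eq: "subshift_of_patterns G A P = {x \<in> configurations G A. \<forall>g\<in>carrier G. \<forall>p\<in>P.
      \<not> (\<forall>h\<in>dom p. x (inv g \<otimes> h) = the (p h))}"
    unfolding subshift_of_patterns_def using assms
    by (intro Collect_cong conj_cong ball_cong refl) (simp add: shift_in_cylinder_iff subset_iff)
  show ?thesis
    unfolding eq using assms by (intro closedin_avoiding) (auto simp: patterns_def)
qed

lemma subshift_subshift_of_codings:
  assumes S: "S \<subseteq> carrier G" and C: "C \<subseteq> pattern_codings S A"
  shows "subshift G A (subshift_of_codings G A C)"
proof -
  have val: "word_value G w \<in> carrier G" if "c \<in> C" "w \<in> dom c" for c w
    using that C S word_value_closed[of w S] by (auto simp: pattern_codings_def subset_iff)
  have eq: "subshift_of_codings G A C = {x \<in> configurations G A. \<forall>g\<in>carrier G. \<forall>c\<in>C.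
      \<not> (\<forall>w\<in>dom c. x (inv g \<otimes> word_value G w) = the (c w))}"
    unfolding subshift_of_codings_def using C
    by (intro Collect_cong conj_cong ball_cong refl)
      (simp add: shift_in_coding_cylinder_iff[OF S] subset_iff)
  have "closedin (full_shift G A) (subshift_of_codings G A C)"
    unfolding eq using C val
    by (intro closedin_avoiding) (auto simp: pattern_codings_def)
  moreover have "shift G g x \<in> subshift_of_codings G A C"
    if "g \<in> carrier G" "x \<in> subshift_of_codings G A C" for g x
    using that by (auto simp: subshift_of_codings_def shift_shift shift_configurations
        simp del: PiE_iff)
  ultimately show ?thesis unfolding subshift_def by blast
qed

text \<open>
  One half of the Curtis--Hedlund--Lyndon theorem. The value at \<open>\<one>\<close> is locally constant, hence
  determined near each point by finitely many coordinates, and compactness makes this set of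
  coordinates uniform.
\<close>

lemma continuous_map_local_rule:
  assumes B: "finite B" and X: "closedin (full_shift G B) X"
    and \<phi>: "continuous_map (subtopology (full_shift G B) X) (full_shift G A) \<phi>"
  obtains M where "finite M" "M \<subseteq> carrier G"
    "\<And>x x'. x \<in> X \<Longrightarrow> x' \<in> X \<Longrightarrow> (\<And>h. h \<in> M \<Longrightarrow> x h = x' h) \<Longrightarrow> \<phi> x \<one> = \<phi> x' \<one>"
proof -
  let ?T = "subtopology (full_shift G B) X"
  have X_sub: "X \<subseteq> configurations G B"
    using closedin_subset[OF X] by simp
  have top: "topspace ?T = X" using X_sub by (auto simp: topspace_subtopology)
  have "\<exists>M. finite M \<and> M \<subseteq> carrier G \<and>
      (\<forall>x'\<in>X. (\<forall>h\<in>M. x' h = x h) \<longrightarrow> \<phi> x' \<one> = \<phi> x \<one>)" if "x \<in> X" for x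
  proof -
    have "openin ?T {x' \<in> topspace ?T. \<phi> x' \<in> {y \<in> configurations G A. y \<one> = \<phi> x \<one>}}"
      using \<phi> by (rule openin_continuous_map_preimage) (simp add: openin_full_shift_coordinate)
    then obtain U where U: "openin (full_shift G B) U"
      "{x' \<in> topspace ?T. \<phi> x' \<in> {y \<in> configurations G A. y \<one> = \<phi> x \<one>}} = U \<inter> X"
      unfolding openin_subtopology by blast
    have "\<phi> x \<in> configurations G A"
      using continuous_map_image_subset_topspace[OF \<phi>] that top by auto
    then have "x \<in> U" using U(2) that top by blast
    moreover have "\<forall>x\<in>U. \<exists>V. finite {h \<in> carrier G. V h \<noteq> topspace (discrete_topology B)} \<and>
        (\<forall>h\<in>carrier G. openin (discrete_topology B) (V h)) \<and> x \<in> Pi\<^sub>E (carrier G) V \<and>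
        Pi\<^sub>E (carrier G) V \<subseteq> U"
      using U(1) by (simp only: full_shift_def openin_product_topology_alt)
    ultimately obtain V where V: "finite {h \<in> carrier G. V h \<noteq> topspace (discrete_topology B)}"
      "x \<in> Pi\<^sub>E (carrier G) V" "Pi\<^sub>E (carrier G) V \<subseteq> U"
      by blast
    let ?M = "{h \<in> carrier G. V h \<noteq> topspace (discrete_topology B)}"
    have "\<phi> x' \<one> = \<phi> x \<one>" if x': "x' \<in> X" "\<forall>h\<in>?M. x' h = x h" for x'
    proof -
      have "x' \<in> configurations G B" using x'(1) X_sub by blast
      then have "x' \<in> Pi\<^sub>E (carrier G) V"
        using x'(2) V(2) by (simp add: PiE_iff) metis
      then show ?thesis using V(3) U(2) x'(1) by blast
    qed
    then show ?thesis using V(1) by (intro exI[of _ ?M]) blast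
  qed
  then obtain M where M: "\<And>x. x \<in> X \<Longrightarrow> finite (M x)" "\<And>x. x \<in> X \<Longrightarrow> M x \<subseteq> carrier G"
    "\<And>x x'. x \<in> X \<Longrightarrow> x' \<in> X \<Longrightarrow> \<forall>h\<in>M x. x' h = x h \<Longrightarrow> \<phi> x' \<one> = \<phi> x \<one>"
    by metis
  define V where "V = (\<lambda>x. {x' \<in> X. \<forall>h\<in>M x. x' h = x h})"
  have "openin ?T (V x)" if "x \<in> X" for x
  proof -
    have "V x = {x' \<in> configurations G B. \<forall>h\<in>M x. x' h = x h} \<inter> X"
      using X_sub unfolding V_def by blast
    moreover have "openin (full_shift G B) {x' \<in> configurations G B. \<forall>h\<in>M x. x' h = x h}"
      using M(1,2)[OF that] by (intro openin_full_shift_agree) auto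
    ultimately show ?thesis unfolding openin_subtopology by (intro exI conjI)
  qed
  moreover have "compact_space ?T"
  proof -
    have "compact_space (full_shift G B)"
      unfolding full_shift_def using B
      by (simp add: compact_space_product_topology compact_space_discrete_topology)
    then show ?thesis
      using X closedin_compact_space compact_space_subtopology by blast
  qed
  moreover have "X \<subseteq> \<Union> (V ` X)" unfolding V_def by auto
  ultimately have "\<exists>\<F>. finite \<F> \<and> \<F> \<subseteq> V ` X \<and> X \<subseteq> \<Union> \<F>"
    unfolding compact_space_alt top by simp
  then obtain \<F> where "finite \<F>" "\<F> \<subseteq> V ` X" "X \<subseteq> \<Union> \<F>" by blast
  then obtain X0 where X0: "finite X0" "X0 \<subseteq> X" "X \<subseteq> \<Union> (V ` X0)"
    using finite_subset_image by metis
  show ?thesis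
  proof (rule that[of "\<Union> (M ` X0)"])
    fix x x' assume xx: "x \<in> X" "x' \<in> X" "\<And>h. h \<in> \<Union> (M ` X0) \<Longrightarrow> x h = x' h"
    then obtain z where z: "z \<in> X0" "x \<in> V z" using X0(3) by blast
    then have "\<forall>h\<in>M z. x h = z h" by (simp add: V_def)
    moreover from this have "\<forall>h\<in>M z. x' h = z h" using xx(3) z(1) by force
    ultimately show "\<phi> x \<one> = \<phi> x' \<one>" using M(3)[of z] xx(1,2) z(1) X0(2) by (metis subsetD)
  next
    show "\<Union> (M ` X0) \<subseteq> carrier G" using M(2) X0(2) by blast
  qed (use X0 M(1) in auto)
qed

end

section \<open>Exchanging patterns in sofic subshifts\<close>

text \<open>
  The forbidden patterns and the block map look at translates \<open>g D\<close> of a finite set. The boundary is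
  the union of those translates that meet both \<open>W\<close> and its complement.
\<close>

definition (in group) boundary :: "'a set \<Rightarrow> 'a set \<Rightarrow> 'a set" where
  "boundary D W = {g \<otimes> d | g d. g \<in> carrier G \<and> d \<in> D \<and>
     (\<exists>d\<in>D. g \<otimes> d \<in> W) \<and> (\<exists>d\<in>D. g \<otimes> d \<notin> W)}"

context group
begin

text \<open>
  If \<open>g d\<^sub>1 \<in> W\<close> and \<open>g d\<^sub>2 \<notin> W\<close>, then \<open>g d\<^sub>2\<close> lies in the right translate of \<open>W\<close> by \<open>d\<^sub>1\<^sup>-\<^sup>1 d\<^sub>2\<close> but not in
  \<open>W\<close>, and \<open>g d\<close> is a right translate of \<open>g d\<^sub>2\<close>. So the boundary is small when \<open>W\<close> is almost invariant
  under right translations.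
\<close>

lemma boundary_subset:
  assumes "D \<subseteq> carrier G"
  shows "boundary D W \<subseteq> (\<Union>(d, d1, d2)\<in>D \<times> D \<times> D.
    (\<lambda>x. x \<otimes> (inv d2 \<otimes> d)) ` ((\<lambda>w. w \<otimes> (inv d1 \<otimes> d2)) ` W - W))"
proof
  fix b assume "b \<in> boundary D W"
  then obtain g d d1 d2 where b: "b = g \<otimes> d" and g: "g \<in> carrier G"
    and d: "d \<in> D" "d1 \<in> D" "d2 \<in> D" and W: "g \<otimes> d1 \<in> W" "g \<otimes> d2 \<notin> W"
    unfolding boundary_def by blast
  note c = g subsetD[OF assms d(1)] subsetD[OF assms d(2)] subsetD[OF assms d(3)]
  have "(g \<otimes> d1) \<otimes> (inv d1 \<otimes> d2) = g \<otimes> d2" "b = (g \<otimes> d2) \<otimes> (inv d2 \<otimes> d)"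
    using c b by (simp_all add: m_assoc inv_solve_left)
      (simp_all add: m_assoc[symmetric])
  then have "b \<in> (\<lambda>x. x \<otimes> (inv d2 \<otimes> d)) ` ((\<lambda>w. w \<otimes> (inv d1 \<otimes> d2)) ` W - W)"
    using W by (metis DiffI imageI)
  then show "b \<in> (\<Union>(d, d1, d2)\<in>D \<times> D \<times> D.
      (\<lambda>x. x \<otimes> (inv d2 \<otimes> d)) ` ((\<lambda>w. w \<otimes> (inv d1 \<otimes> d2)) ` W - W))"
    using d by force
qed

lemma finite_boundary:
  assumes "finite D" "D \<subseteq> carrier G" "finite W"
  shows "finite (boundary D W)"
  using assms by (intro finite_subset[OF boundary_subset]) auto

lemma card_boundary_le:
  assumes D: "finite D" "D \<subseteq> carrier G" and W: "finite W"
    and r: "\<And>d1 d2. d1 \<in> D \<Longrightarrow> d2 \<in> D \<Longrightarrow>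
      real (card ((\<lambda>w. w \<otimes> (inv d1 \<otimes> d2)) ` W - W)) \<le> r"
  shows "real (card (boundary D W)) \<le> real (card D ^ 3) * r"
proof -
  let ?B = "\<lambda>(d, d1, d2). (\<lambda>x. x \<otimes> (inv d2 \<otimes> d)) ` ((\<lambda>w. w \<otimes> (inv d1 \<otimes> d2)) ` W - W)"
  have "card (boundary D W) \<le> card (\<Union>t\<in>D \<times> D \<times> D. ?B t)"
    using boundary_subset[OF D(2)] D W by (intro card_mono) auto
  also have "\<dots> \<le> (\<Sum>t\<in>D \<times> D \<times> D. card (?B t))"
    using D W by (intro card_UN_le) auto
  finally have "real (card (boundary D W)) \<le> real (\<Sum>t\<in>D \<times> D \<times> D. card (?B t))"
    by (rule of_nat_mono)
  also have "\<dots> = (\<Sum>t\<in>D \<times> D \<times> D. real (card (?B t)))"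
    by (rule of_nat_sum)
  also have "\<dots> \<le> of_nat (card (D \<times> D \<times> D)) * r"
  proof (rule sum_bounded_above)
    fix t assume "t \<in> D \<times> D \<times> D"
    then obtain d d1 d2 where t: "t = (d, d1, d2)" "d1 \<in> D" "d2 \<in> D" by auto
    have "card (?B t) \<le> card ((\<lambda>w. w \<otimes> (inv d1 \<otimes> d2)) ` W - W)"
      unfolding t using W by (auto intro!: card_image_le)
    then show "real (card (?B t)) \<le> r" using r[OF t(2,3)] by linarith
  qed
  finally show ?thesis by (simp add: card_cartesian_product power3_eq_cube mult.assoc)
qed

text \<open>
  Two points of the covering subshift of finite type that agree on the boundary of \<open>W\<close> can be cut along
  \<open>W\<close> and pasted together: a forbidden pattern or a window of the block map that sees both sides lies in
  the boundary, so what it sees occurs in one of the two points.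
  The images are then cut along \<open>W\<close> as well. There are at most \<open>card B ^ card (boundary D W)\<close> contents of
  the boundary, so the pigeonhole principle applies to any larger family of points of the sofic
  subshift. Both exchanges are stated since the application knows only one of them to be impossible.
\<close>

lemma sofic_exchange:
  assumes "sofic G A Y"
  obtains D :: "'a set" and m :: nat where "finite D" "D \<subseteq> carrier G"
    "\<forall>W \<Y>. finite W \<longrightarrow> W \<subseteq> carrier G \<longrightarrow> \<Y> \<subseteq> Y \<longrightarrow>
      2 ^ (m * card (boundary D W)) < card \<Y> \<longrightarrow>
      (\<exists>y\<in>\<Y>. \<exists>y'\<in>\<Y>. y \<noteq> y' \<and> override_on y' y W \<in> Y \<and> override_on y y' W \<in> Y)"
proof -
  obtain B :: "nat set" and X \<phi> where B: "finite B" and "sft G B X"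
    and cont: "continuous_map (subtopology (full_shift G B) X) (subtopology (full_shift G A) Y) \<phi>"
    and equivariant: "\<And>g x. g \<in> carrier G \<Longrightarrow> x \<in> X \<Longrightarrow> \<phi> (shift G g x) = shift G g (\<phi> x)"
    and onto: "\<phi> ` X = Y"
    using assms unfolding sofic_def by blast
  then obtain P where P: "finite P" "P \<subseteq> patterns G B" and X: "X = subshift_of_patterns G B P"
    unfolding sft_def by blast
  have closed: "closedin (full_shift G B) X"
    unfolding X using P(2) by (rule closedin_subshift_of_patterns)
  have \<phi>: "continuous_map (subtopology (full_shift G B) X) (full_shift G A) \<phi>"
    using cont by (rule continuous_map_into_fulltopology)
  obtain M where M: "finite M" "M \<subseteq> carrier G"
    "\<And>x x'. x \<in> X \<Longrightarrow> x' \<in> X \<Longrightarrow> (\<And>h. h \<in> M \<Longrightarrow> x h = x' h) \<Longrightarrow> \<phi> x \<one> = \<phi> x' \<one>"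
    using continuous_map_local_rule[OF B closed \<phi>] by metis
  have X_sub: "X \<subseteq> configurations G B" using closedin_subset[OF closed] by simp
  have shift_X: "shift G g x \<in> X" if "g \<in> carrier G" "x \<in> X" for g x
    using that unfolding X subshift_of_patterns_def
    by (simp add: shift_shift shift_configurations del: PiE_iff)
  have \<phi>_conf: "\<phi> x \<in> configurations G A" if "x \<in> X" for x
    using continuous_map_image_subset_topspace[OF \<phi>] X_sub that
    by (simp add: topspace_subtopology Int_absorb1 del: PiE_iff) blast
  have \<phi>_at: "\<phi> x g = \<phi> (shift G (inv g) x) \<one>" if "g \<in> carrier G" "x \<in> X" for x g
    using that by (simp add: equivariant shift_apply)
  \<comment> \<open>The identity belongs to the window so that a translate of it records on which side its base lies.\<close>
  define D where "D = insert \<one> (M \<union> (\<Union>p\<in>P. dom p))"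
  have D: "finite D" "D \<subseteq> carrier G"
    using M(1,2) P unfolding D_def patterns_def by auto
  have glue: "override_on x' x W \<in> X \<and> \<phi> (override_on x' x W) = override_on (\<phi> x') (\<phi> x) W"
    if x: "x \<in> X" "x' \<in> X" and W: "W \<subseteq> carrier G"
      and agree: "\<And>b. b \<in> boundary D W \<Longrightarrow> x b = x' b" for x x' W
  proof -
    define z where "z = override_on x' x W"
    have z_conf: "z \<in> configurations G B"
      using x X_sub W unfolding z_def override_on_def by (auto simp: PiE_iff extensional_def)
    have near: "z (g \<otimes> d) = (if g \<in> W then x else x') (g \<otimes> d)"
      if g: "g \<in> carrier G" and d: "d \<in> D" for g d
    proof (cases "g \<in> W \<longleftrightarrow> g \<otimes> d \<in> W")
      case True
      then show ?thesis by (simp add: z_def override_on_def)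
    next
      case False
      have "g \<otimes> \<one> = g" "\<one> \<in> D" using g by (simp_all add: D_def)
      then have "g \<otimes> d \<in> boundary D W"
        using False g d unfolding boundary_def by (smt (verit) mem_Collect_eq)
      then show ?thesis using agree by (simp add: z_def override_on_def)
    qed
    have "shift G g z \<notin> cylinder G B p" if g: "g \<in> carrier G" and p: "p \<in> P" for g p
    proof -
      let ?x = "if inv g \<in> W then x else x'"
      have "?x \<in> X" using x by simp
      then have "shift G g ?x \<notin> cylinder G B p" "?x \<in> configurations G B"
        using g p X_sub unfolding X subshift_of_patterns_def by auto
      moreover have "z (inv g \<otimes> h) = ?x (inv g \<otimes> h)" if "h \<in> dom p" for h
      proof -
        have "h \<in> D" using p that unfolding D_def by blast
        then show ?thesis using near[of "inv g" h] g by simp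
      qed
      ultimately show ?thesis
        using shift_in_cylinder_iff[OF g, of _ B p] z_conf p P(2) by auto
    qed
    then have z: "z \<in> X" using z_conf unfolding X subshift_of_patterns_def by blast
    have "\<phi> z g = override_on (\<phi> x') (\<phi> x) W g" for g
    proof (cases "g \<in> carrier G")
      case True
      let ?x = "if g \<in> W then x else x'"
      have "\<phi> (shift G (inv g) z) \<one> = \<phi> (shift G (inv g) ?x) \<one>"
      proof (rule M(3))
        show "shift G (inv g) z h = shift G (inv g) ?x h" if "h \<in> M" for h
          using near[OF True, of h] that M(2) True by (auto simp: D_def shift_apply)
      qed (use shift_X z x True in auto)
      then show ?thesis
        using \<phi>_at[OF True z] \<phi>_at[OF True x(1)] \<phi>_at[OF True x(2)]
        by (auto simp: override_on_def)
    next
      case False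
      then have "\<phi> v g = undefined" if "v \<in> X" for v
        using \<phi>_conf[OF that] by (auto simp: PiE_iff extensional_def)
      then show ?thesis using z x False W by (auto simp: override_on_def)
    qed
    then show ?thesis using z unfolding z_def by auto
  qed
  have "\<exists>y\<in>\<Y>. \<exists>y'\<in>\<Y>. y \<noteq> y' \<and> override_on y' y W \<in> Y \<and> override_on y y' W \<in> Y"
    if W: "finite W" "W \<subseteq> carrier G" and \<Y>: "\<Y> \<subseteq> Y"
      and large: "2 ^ (card B * card (boundary D W)) < card \<Y>" for W \<Y>
  proof -
    let ?b = "boundary D W"
    have b: "finite ?b" "?b \<subseteq> carrier G"
      using finite_boundary[OF D] W(1) D(2) by (auto simp: boundary_def)
    have "\<forall>y\<in>\<Y>. \<exists>x\<in>X. \<phi> x = y" using \<Y> onto by auto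
    then obtain x where x: "\<And>y. y \<in> \<Y> \<Longrightarrow> x y \<in> X \<and> \<phi> (x y) = y" by metis
    have "(\<lambda>y. restrict (x y) ?b) ` \<Y> \<subseteq> ?b \<rightarrow>\<^sub>E B"
      using x X_sub b(2) by (fastforce simp: PiE_iff)
    moreover have "card (?b \<rightarrow>\<^sub>E B) \<le> 2 ^ (card B * card (boundary D W))"
    proof -
      \<comment> \<open>The estimate \<open>card B < 2 ^ card B\<close> gives the exponent \<open>m = card B\<close>.\<close>
      have "card (?b \<rightarrow>\<^sub>E B) = card B ^ card ?b" using b(1) by (simp add: card_PiE)
      also have "\<dots> \<le> (2 ^ card B) ^ card ?b"
        by (intro power_mono less_imp_le[OF less_exp]) simp
      finally show ?thesis by (simp add: power_mult)
    qed
    moreover have "finite (?b \<rightarrow>\<^sub>E B)" using b(1) B by (intro finite_PiE)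
    ultimately have "card ((\<lambda>y. restrict (x y) ?b) ` \<Y>) < card \<Y>"
      using large card_mono[of "?b \<rightarrow>\<^sub>E B"] by (meson le_less_trans le_trans)
    then have "\<not> inj_on (\<lambda>y. restrict (x y) ?b) \<Y>"
      using pigeonhole by blast
    then obtain y y' where yy: "y \<in> \<Y>" "y' \<in> \<Y>" "y \<noteq> y'"
      and r: "restrict (x y) ?b = restrict (x y') ?b"
      unfolding inj_on_def by blast
    have "x y b = x y' b" if "b \<in> ?b" for b
      using fun_cong[OF r, of b] that by simp
    then have "override_on y' y W \<in> Y" "override_on y y' W \<in> Y"
      using glue[of "x y" "x y'" W] glue[of "x y'" "x y" W] x[OF yy(1)] x[OF yy(2)] W(2) onto
      by (metis imageI)+
    then show ?thesis using yy by blast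
  qed
  then show ?thesis using that D by blast
qed

text \<open>
  The inverses of a set that is almost invariant under left translations form a set that is almost
  invariant under right translations.
\<close>

lemma amenable_right_invariant:
  assumes "amenable G" "finite E" "E \<subseteq> carrier G" "\<epsilon> > 0"
  obtains F where "finite F" "F \<noteq> {}" "F \<subseteq> carrier G"
    "\<forall>s\<in>E. real (card ((\<lambda>f. f \<otimes> s) ` F - F)) \<le> \<epsilon> * real (card F)"
proof -
  have "finite (m_inv G ` E)" "m_inv G ` E \<subseteq> carrier G" using assms by auto
  then obtain F where F: "finite F" "F \<noteq> {}" "F \<subseteq> carrier G"
    and small: "\<And>g. g \<in> m_inv G ` E \<Longrightarrow> real (card (sym_diff (g <# F) F)) \<le> \<epsilon> * real (card F)"
    using assms(1,4) unfolding amenable_def by meson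
  let ?F = "m_inv G ` F"
  have card: "card ?F = card F"
    using F(3) by (intro card_image inj_on_subset[OF inv_inj])
  show ?thesis
  proof (rule that[of ?F], goal_cases)
    case 4
    show ?case
    proof
      fix s assume s: "s \<in> E"
      then have sc: "s \<in> carrier G" using assms(3) by auto
      have "(\<lambda>f. f \<otimes> s) ` ?F - ?F \<subseteq> m_inv G ` (sym_diff (inv s <# F) F)"
      proof
        fix x assume x: "x \<in> (\<lambda>f. f \<otimes> s) ` ?F - ?F"
        then obtain f where f: "f \<in> F" "x = inv f \<otimes> s" by auto
        have fc: "f \<in> carrier G" using f F by auto
        have "x = inv (inv s \<otimes> f)" using f sc fc by (simp add: inv_mult_group)
        moreover have "inv s \<otimes> f \<in> inv s <# F" using f by (auto simp: l_coset_def)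
        moreover have "inv s \<otimes> f \<notin> F" using x calculation by auto
        ultimately show "x \<in> m_inv G ` (sym_diff (inv s <# F) F)" by auto
      qed
      moreover have "finite (sym_diff (inv s <# F) F)" using F by (auto simp: l_coset_def)
      ultimately have "card ((\<lambda>f. f \<otimes> s) ` ?F - ?F) \<le> card (sym_diff (inv s <# F) F)"
        by (rule surj_card_le[rotated])
      then show "real (card ((\<lambda>f. f \<otimes> s) ` ?F - ?F)) \<le> \<epsilon> * real (card ?F)"
        using small[of "inv s"] s card by auto
    qed
  qed (use F in auto)
qed

end

lemma amenable_right_invariant_product:
  assumes H: "group H" "amenable H" and K: "group K" "amenable K"
    and E: "finite E" "E \<subseteq> carrier (H \<times>\<times> K)" and \<epsilon>: "\<epsilon> > 0"
  obtains F F' where "finite F" "F \<noteq> {}" "F \<subseteq> carrier H" "finite F'" "F' \<noteq> {}" "F' \<subseteq> carrier K"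
    "\<forall>s\<in>E. real (card ((\<lambda>f. f \<otimes>\<^bsub>H \<times>\<times> K\<^esub> s) ` (F \<times> F') - F \<times> F'))
      \<le> \<epsilon> * real (card (F \<times> F'))"
proof -
  have "finite (fst ` E)" "fst ` E \<subseteq> carrier H" "finite (snd ` E)" "snd ` E \<subseteq> carrier K"
    using E by auto
  then obtain F F' where F: "finite F" "F \<noteq> {}" "F \<subseteq> carrier H"
    and F': "finite F'" "F' \<noteq> {}" "F' \<subseteq> carrier K"
    and small: "\<And>s. s \<in> fst ` E \<Longrightarrow>
      real (card ((\<lambda>f. f \<otimes>\<^bsub>H\<^esub> s) ` F - F)) \<le> \<epsilon> / 2 * real (card F)"
    and small': "\<And>s. s \<in> snd ` E \<Longrightarrow>
      real (card ((\<lambda>f. f \<otimes>\<^bsub>K\<^esub> s) ` F' - F')) \<le> \<epsilon> / 2 * real (card F')"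
    using group.amenable_right_invariant[OF H, of "fst ` E" "\<epsilon> / 2"]
      group.amenable_right_invariant[OF K, of "snd ` E" "\<epsilon> / 2"] \<epsilon>
    by (metis half_gt_zero)
  have "real (card ((\<lambda>f. f \<otimes>\<^bsub>H \<times>\<times> K\<^esub> s) ` (F \<times> F') - F \<times> F')) \<le> \<epsilon> * real (card (F \<times> F'))"
    if "s \<in> E" for s
  proof -
    obtain a b where s: "s = (a, b)" by (cases s)
    let ?a = "(\<lambda>f. f \<otimes>\<^bsub>H\<^esub> a) ` F" and ?b = "(\<lambda>f. f \<otimes>\<^bsub>K\<^esub> b) ` F'"
    have "(\<lambda>f. f \<otimes>\<^bsub>H \<times>\<times> K\<^esub> s) ` (F \<times> F') - F \<times> F' \<subseteq> (?a - F) \<times> ?b \<union> ?a \<times> (?b - F')"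
      unfolding s by auto
    then have "card ((\<lambda>f. f \<otimes>\<^bsub>H \<times>\<times> K\<^esub> s) ` (F \<times> F') - F \<times> F') \<le>
        card ((?a - F) \<times> ?b \<union> ?a \<times> (?b - F'))"
      using F(1) F'(1) by (intro card_mono) auto
    also have "\<dots> \<le> card (?a - F) * card ?b + card ?a * card (?b - F')"
      by (rule order_trans[OF card_Un_le]) (simp add: card_cartesian_product)
    also have "\<dots> \<le> card (?a - F) * card F' + card F * card (?b - F')"
      using F(1) F'(1) by (intro add_mono mult_mono card_image_le) auto
    finally have "real (card ((\<lambda>f. f \<otimes>\<^bsub>H \<times>\<times> K\<^esub> s) ` (F \<times> F') - F \<times> F')) \<le>
        real (card (?a - F) * card F' + card F * card (?b - F'))"
      by (rule of_nat_mono)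
    also have "\<dots> = real (card (?a - F)) * real (card F') + real (card F) * real (card (?b - F'))"
      by simp
    also have "\<dots> \<le> (\<epsilon> / 2 * real (card F)) * real (card F') +
        real (card F) * (\<epsilon> / 2 * real (card F'))"
      using small[of a] small'[of b] that s by (intro add_mono mult_mono) force+
    finally show ?thesis by (simp add: card_cartesian_product)
  qed
  then show ?thesis using that F F' by blast
qed

section \<open>The transport shift\<close>

definition transport_shift :: "('g, 'm) monoid_scheme \<Rightarrow> 'g set \<Rightarrow> ('g \<Rightarrow> nat) set" where
  "transport_shift G S = subshift_of_codings G {..<5} (clashes S)"

text \<open>
  The source mark is at \<open>a\<close> and the target mark at \<open>t a\<close>. A subset \<open>Q\<close> of \<open>F\<close> is drawn with dots on \<open>F\<close>, and
  its complement in \<open>F\<close> is recorded on the left translate \<open>t F\<close>: a word acts by right multiplication,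
  so a word leading from \<open>a\<close> to \<open>f\<close> leads from \<open>t a\<close> to \<open>t f\<close>.
\<close>

definition (in group) transported :: "'a \<Rightarrow> 'a \<Rightarrow> 'a set \<Rightarrow> 'a set \<Rightarrow> 'a \<Rightarrow> nat" where
  "transported a t F Q = (\<lambda>h\<in>carrier G.
     if h = a then 3 else if h = t \<otimes> a then 4
     else if h \<in> Q then 1 else if h \<in> (\<otimes>) t ` (F - Q) then 2 else 0)"

context group
begin

text \<open>
  A word \<open>s v\<close> representing \<open>\<one>\<close> can be put in front of any word.
\<close>

lemma ex_long_word:
  assumes S: "finite_word_generating G S" "S \<noteq> {}" and h: "h \<in> carrier G"
  shows "\<exists>w\<in>lists S. word_value G w = h \<and> n < length w"
proof -
  have S': "S \<subseteq> carrier G" "word_value G ` lists S = carrier G"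
    using S(1) by (auto simp: finite_word_generating_def)
  obtain s where s: "s \<in> S" using S(2) by auto
  then have sc: "s \<in> carrier G" using S'(1) by auto
  then obtain v where v: "v \<in> lists S" "word_value G v = inv s"
    using S'(2) by (metis imageE inv_closed)
  have longer: "word_value G (s # v @ w) = word_value G w" if w: "w \<in> lists S" for w
  proof -
    have "word_value G (s # v @ w) = s \<otimes> (inv s \<otimes> word_value G w)"
      using word_value_append[OF v(1) w S'(1)] v(2) by (simp add: word_value_def)
    then show ?thesis
      using sc word_value_closed[OF w S'(1)] by (simp add: m_assoc[symmetric])
  qed
  show ?thesis
  proof (induction n)
    case 0
    obtain w where "w \<in> lists S" "word_value G w = h" using S'(2) h by (metis imageE)
    then show ?case using longer s v(1) by (intro bexI[of _ "s # v @ w"]) auto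
  next
    case (Suc n)
    then obtain w where "w \<in> lists S" "word_value G w = h" "n < length w" by auto
    then show ?case using longer s v(1) by (intro bexI[of _ "s # v @ w"]) auto
  qed
qed

text \<open>
  Every pair of elements is represented by words \<open>w\<close> and \<open>u\<close> with \<open>0 < length w < length u\<close>, so the
  restriction on lengths disappears when the rule is read on group elements.
\<close>

lemma transport_shift_iff:
  assumes S: "finite_word_generating G S" "S \<noteq> {}"
  shows "x \<in> transport_shift G S \<longleftrightarrow> x \<in> configurations G {..<5} \<and>
    (\<forall>g\<in>carrier G. \<forall>t\<in>carrier G. \<forall>v\<in>carrier G.
      \<not> (x g = 3 \<and> x (g \<otimes> t) = 4 \<and> x (g \<otimes> v) = 1 \<and> x (g \<otimes> (t \<otimes> v)) = 2))"
    (is "_ \<longleftrightarrow> _ \<and> ?P")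
proof -
  have S': "S \<subseteq> carrier G" using S(1) by (simp add: finite_word_generating_def)
  note closed = word_value_closed[OF _ S']
  have forbidden: "shift G (inv g) x \<in> coding_cylinder G {..<5} (clash w u) \<longleftrightarrow>
      x g = 3 \<and> x (g \<otimes> word_value G w) = 4 \<and> x (g \<otimes> word_value G u) = 1 \<and>
      x (g \<otimes> (word_value G w \<otimes> word_value G u)) = 2"
    if x: "x \<in> configurations G {..<5}" and g: "g \<in> carrier G"
      and wu: "w \<in> lists S" "u \<in> lists S" "w \<noteq> []" "length w < length u" for g w u
  proof -
    have conf: "shift G (inv g) x \<in> configurations G {..<5}"
      using x g by (intro shift_configurations) auto
    have at: "shift G (inv g) x (word_value G v) = x (g \<otimes> word_value G v)" if "v \<in> lists S" for v
      using g closed[OF that] by (simp add: shift_apply)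
    have "shift G (inv g) x (word_value G []) = x g"
      using g at[of "[]"] by (simp add: word_value_def)
    moreover have "shift G (inv g) x (word_value G w \<otimes> word_value G u) =
        x (g \<otimes> (word_value G w \<otimes> word_value G u))"
      using g closed[OF wu(1)] closed[OF wu(2)] by (simp add: shift_apply)
    ultimately show ?thesis
      using conf at wu word_value_append[OF wu(1,2) S']
      unfolding coding_cylinder_def
      by (simp add: clash_matches_iff[where f = "\<lambda>v. shift G (inv g) x (word_value G v)"]
          del: PiE_iff append_in_lists_conv)
  qed
  show ?thesis
  proof (intro iffI conjI)
    assume x: "x \<in> transport_shift G S"
    then show conf: "x \<in> configurations G {..<5}"
      by (simp add: transport_shift_def subshift_of_codings_def)
    show ?P
    proof (intro ballI)
      fix g t v assume g: "g \<in> carrier G" "t \<in> carrier G" "v \<in> carrier G"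
      obtain w where w: "w \<in> lists S" "word_value G w = t" "0 < length w"
        using ex_long_word[OF S g(2)] by blast
      obtain u where u: "u \<in> lists S" "word_value G u = v" "length w < length u"
        using ex_long_word[OF S g(3)] by blast
      have "clash w u \<in> clashes S" using w u unfolding clashes_def by auto
      then have "shift G (inv g) x \<notin> coding_cylinder G {..<5} (clash w u)"
        using x g(1) unfolding transport_shift_def subshift_of_codings_def by blast
      then show "\<not> (x g = 3 \<and> x (g \<otimes> t) = 4 \<and> x (g \<otimes> v) = 1 \<and> x (g \<otimes> (t \<otimes> v)) = 2)"
        using forbidden[OF conf g(1) w(1) u(1)] w u by auto
    qed
  next
    assume x: "x \<in> configurations G {..<5} \<and> ?P"
    have "shift G g x \<notin> coding_cylinder G {..<5} c"
      if g: "g \<in> carrier G" and c: "c \<in> clashes S" for g c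
    proof -
      obtain w u where wu: "c = clash w u" "w \<in> lists S" "u \<in> lists S" "w \<noteq> []" "length w < length u"
        using c unfolding clashes_def by auto
      have "inv g \<in> carrier G" using g by simp
      moreover from this have "\<not> (x (inv g) = 3 \<and> x (inv g \<otimes> word_value G w) = 4 \<and>
          x (inv g \<otimes> word_value G u) = 1 \<and> x (inv g \<otimes> (word_value G w \<otimes> word_value G u)) = 2)"
        using x closed[OF wu(2)] closed[OF wu(3)] by blast
      ultimately show ?thesis
        using forbidden[OF conjunct1[OF x] _ wu(2-5), of "inv g"] g wu(1) by simp
    qed
    then show "x \<in> transport_shift G S"
      using x unfolding transport_shift_def subshift_of_codings_def by blast
  qed
qed

lemma transported_in_transport_shift:
  assumes "finite_word_generating G S" "S \<noteq> {}"
    and "a \<in> carrier G" "t \<in> carrier G" "F \<subseteq> carrier G"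
  shows "transported a t F Q \<in> transport_shift G S"
proof -
  have "\<not> (transported a t F Q g = 3 \<and> transported a t F Q (g \<otimes> r) = 4 \<and>
      transported a t F Q (g \<otimes> v) = 1 \<and> transported a t F Q (g \<otimes> (r \<otimes> v)) = 2)"
    if c: "g \<in> carrier G" "r \<in> carrier G" "v \<in> carrier G" for g r v
  proof
    assume *: "transported a t F Q g = 3 \<and> transported a t F Q (g \<otimes> r) = 4 \<and>
      transported a t F Q (g \<otimes> v) = 1 \<and> transported a t F Q (g \<otimes> (r \<otimes> v)) = 2"
    have "g = a" "g \<otimes> r = t \<otimes> a" "g \<otimes> v \<in> Q" "g \<otimes> (r \<otimes> v) \<in> (\<otimes>) t ` (F - Q)"
      using * c by (auto simp: transported_def split: if_splits)
    then obtain f where f: "f \<in> F" "f \<notin> Q" "g \<otimes> (r \<otimes> v) = t \<otimes> f" by auto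
    \<comment> \<open>The element \<open>g v\<close> would lie both in \<open>Q\<close> and in its complement.\<close>
    have "t \<otimes> (g \<otimes> v) = t \<otimes> f"
      using f(3) \<open>g \<otimes> r = t \<otimes> a\<close> \<open>g = a\<close> c assms(3,4) by (simp add: m_assoc[symmetric])
    then have "g \<otimes> v = f" using c f(1) assms(4,5) by auto
    then show False using f(2) \<open>g \<otimes> v \<in> Q\<close> by simp
  qed
  moreover have "transported a t F Q \<in> configurations G {..<5}"
    by (auto simp: transported_def)
  ultimately show ?thesis
    by (intro iffD2[OF transport_shift_iff[OF assms(1,2)]] conjI ballI)
qed

text \<open>
  The two marks, the set \<open>F\<close> and its translate \<open>t F\<close> do not interfere with each other, so that \<open>F\<close>
  contains the drawing and nothing else.
\<close>

definition separates :: "'a \<Rightarrow> 'a \<Rightarrow> 'a set \<Rightarrow> bool" where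
  "separates a t F \<longleftrightarrow> a \<in> carrier G \<and> t \<in> carrier G \<and> t \<otimes> a \<noteq> a \<and>
     (\<otimes>) t ` F \<inter> F = {} \<and> a \<notin> F \<and> a \<notin> (\<otimes>) t ` F \<and> t \<otimes> a \<notin> F"

text \<open>
  Each condition excludes finitely many elements, first for \<open>t\<close> and then for \<open>a\<close>.
\<close>

lemma ex_separates:
  assumes inf: "infinite (carrier G)" and F: "finite F" "F \<subseteq> carrier G"
  shows "\<exists>a t. separates a t F"
proof -
  have "finite (insert \<one> ((\<lambda>(f, f'). f' \<otimes> inv f) ` (F \<times> F)))" using F(1) by auto
  then obtain t where t: "t \<in> carrier G" "t \<notin> insert \<one> ((\<lambda>(f, f'). f' \<otimes> inv f) ` (F \<times> F))"
    using inf by (meson finite_subset subsetI)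
  have "finite (F \<union> (\<otimes>) t ` F \<union> (\<otimes>) (inv t) ` F)" using F(1) by auto
  then obtain a where a: "a \<in> carrier G" "a \<notin> F \<union> (\<otimes>) t ` F \<union> (\<otimes>) (inv t) ` F"
    using inf by (meson finite_subset subsetI)
  have "t \<otimes> f \<notin> F" if f: "f \<in> F" for f
  proof
    assume "t \<otimes> f \<in> F"
    moreover have "t = (t \<otimes> f) \<otimes> inv f" using f F(2) t(1) by (auto simp: m_assoc subset_iff)
    ultimately show False using t(2) f by (auto simp: image_iff)
  qed
  moreover have "t \<otimes> a \<notin> F"
  proof
    assume "t \<otimes> a \<in> F"
    moreover have "a = inv t \<otimes> (t \<otimes> a)" using a(1) t(1) by (simp add: m_assoc[symmetric])
    ultimately show False using a(2) by blast
  qed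
  moreover have "t \<otimes> a \<noteq> a" using a(1) t by simp
  ultimately show ?thesis unfolding separates_def using a t by blast
qed

lemma transported_on:
  assumes "separates a t F" "v \<in> F" "v \<in> carrier G"
  shows "transported a t F Q v = 1 \<longleftrightarrow> v \<in> Q"
  using assms by (auto simp: transported_def separates_def)

text \<open>
  The outside of \<open>F\<close> knows which subset is drawn inside: if the drawing of \<open>Q\<close> is put into the
  surroundings of \<open>Q'\<close>, an element of \<open>Q - Q'\<close> has a dot in \<open>F\<close>, while its translate denies the dot.
\<close>

lemma override_transported_notin:
  assumes S: "finite_word_generating G S" "S \<noteq> {}" and sep: "separates a t F"
    and F: "F \<subseteq> carrier G" and Q': "Q' \<subseteq> F" and v: "v \<in> F" "v \<in> Q" "v \<notin> Q'"
  shows "override_on (transported a t F Q') (transported a t F Q) F \<notin> transport_shift G S"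
proof
  let ?z = "override_on (transported a t F Q') (transported a t F Q) F"
  assume z: "?z \<in> transport_shift G S"
  have c: "a \<in> carrier G" "t \<in> carrier G" "v \<in> carrier G"
    using sep F v(1) by (auto simp: separates_def)
  have tv: "t \<otimes> v \<notin> F" "t \<otimes> v \<noteq> a" "t \<otimes> v \<noteq> t \<otimes> a"
    using sep v(1) c by (auto simp: separates_def)
  have "?z a = 3" "?z (t \<otimes> a) = 4"
    using sep c by (auto simp: separates_def transported_def override_on_def)
  moreover have "?z v = 1"
    using transported_on[OF sep v(1) c(3)] v by (simp add: override_on_def)
  moreover have "?z (t \<otimes> v) = 2"
    using tv c v Q' by (auto simp: transported_def override_on_def)
  \<comment> \<open>Seen from \<open>a\<close>, the target is at \<open>a\<^sup>-\<^sup>1 t a\<close> and the dot at \<open>a\<^sup>-\<^sup>1 v\<close>.\<close>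
  moreover have "a \<otimes> (inv a \<otimes> t \<otimes> a) = t \<otimes> a" "a \<otimes> (inv a \<otimes> v) = v"
    "a \<otimes> ((inv a \<otimes> t \<otimes> a) \<otimes> (inv a \<otimes> v)) = t \<otimes> v"
    using c by (simp_all add: m_assoc inv_solve_left) (simp_all add: m_assoc[symmetric])
  moreover have "inv a \<otimes> t \<otimes> a \<in> carrier G" "inv a \<otimes> v \<in> carrier G" using c by auto
  ultimately show False
    using z c(1) unfolding transport_shift_iff[OF S] by metis
qed

end

section \<open>The free extension of the transport shift\<close>

text \<open>
  The restriction to the coset through \<open>(g, k)\<close> is the slice at \<open>k\<close> shifted by \<open>g\<^sup>-\<^sup>1\<close>.
\<close>

lemma free_extension_iff_slices:
  assumes H: "group H" and K: "group K" and X: "subshift H A X"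
  shows "x \<in> free_extension H K A X \<longleftrightarrow> x \<in> configurations (H \<times>\<times> K) A \<and>
    (\<forall>k\<in>carrier K. (\<lambda>h\<in>carrier H. x (h, k)) \<in> X)"
proof -
  interpret H: group H by fact
  interpret K: group K by fact
  have coset: "(\<lambda>h\<in>carrier H. x ((g, k) \<otimes>\<^bsub>H \<times>\<times> K\<^esub> (h, \<one>\<^bsub>K\<^esub>))) =
      shift H (inv\<^bsub>H\<^esub> g) (\<lambda>h\<in>carrier H. x (h, k))"
    if "g \<in> carrier H" "k \<in> carrier K" for g k
    using that by (auto simp: shift_def intro!: restrict_ext)
  have slice: "shift H (inv\<^bsub>H\<^esub> \<one>\<^bsub>H\<^esub>) (\<lambda>h\<in>carrier H. x (h, k)) = (\<lambda>h\<in>carrier H. x (h, k))" for k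
    by (auto simp: shift_def intro!: restrict_ext)
  show ?thesis
  proof (intro iffI conjI ballI)
    assume x: "x \<in> free_extension H K A X"
    then show "x \<in> configurations (H \<times>\<times> K) A" by (simp add: free_extension_def)
    show "(\<lambda>h\<in>carrier H. x (h, k)) \<in> X" if k: "k \<in> carrier K" for k
    proof -
      have "(\<one>\<^bsub>H\<^esub>, k) \<in> carrier (H \<times>\<times> K)" using k by simp
      then have "(\<lambda>h\<in>carrier H. x ((\<one>\<^bsub>H\<^esub>, k) \<otimes>\<^bsub>H \<times>\<times> K\<^esub> (h, \<one>\<^bsub>K\<^esub>))) \<in> X"
        using x by (simp only: free_extension_def mem_Collect_eq)
      then show ?thesis unfolding coset[OF H.one_closed k] slice .
    qed
  next
    assume x: "x \<in> configurations (H \<times>\<times> K) A \<and> (\<forall>k\<in>carrier K. (\<lambda>h\<in>carrier H. x (h, k)) \<in> X)"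
    have "(\<lambda>h\<in>carrier H. x ((g, k) \<otimes>\<^bsub>H \<times>\<times> K\<^esub> (h, \<one>\<^bsub>K\<^esub>))) \<in> X"
      if "g \<in> carrier H" "k \<in> carrier K" for g k
      unfolding coset[OF that] using x X that by (simp add: subshift_def)
    then show "x \<in> free_extension H K A X"
      using x unfolding free_extension_def by auto
  qed
qed

text \<open>
  On a box \<open>F \<times> F'\<close> the slices over \<open>F'\<close> carry independent drawings, which gives \<open>2 ^ card (F \<times> F')\<close>
  points, no two of which can be exchanged in both directions. Right invariance of the box makes its
  boundary too small for that.
\<close>

lemma free_extension_transport_shift_not_sofic:
  fixes H :: "('h, 'm) monoid_scheme" and K :: "('k, 'n) monoid_scheme"
  assumes H: "group H" "infinite (carrier H)" "finite_word_generating H S" "amenable H"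
    and K: "group K" "amenable K"
  shows "\<not> sofic (H \<times>\<times> K) {..<5} (free_extension H K {..<5} (transport_shift H S))"
proof
  interpret H: group H by fact
  interpret K: group K by fact
  interpret HK: group "H \<times>\<times> K" using DirProd_group[OF H(1) K(1)] .
  let ?Y = "free_extension H K {..<5} (transport_shift H S)"
  assume "sofic (H \<times>\<times> K) {..<5} ?Y"
  then obtain D :: "('h \<times> 'k) set" and m :: nat where D: "finite D" "D \<subseteq> carrier (H \<times>\<times> K)"
    and exchange: "\<forall>W \<Y>. finite W \<longrightarrow> W \<subseteq> carrier (H \<times>\<times> K) \<longrightarrow> \<Y> \<subseteq> ?Y \<longrightarrow>
      2 ^ (m * card (HK.boundary D W)) < card \<Y> \<longrightarrow>
      (\<exists>y\<in>\<Y>. \<exists>y'\<in>\<Y>. y \<noteq> y' \<and> override_on y' y W \<in> ?Y \<and> override_on y y' W \<in> ?Y)"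
    by (rule HK.sofic_exchange)
  have S: "S \<noteq> {}"
    using H(2,3) by (auto simp: finite_word_generating_def dest: sym)
  have shift: "subshift H {..<5} (transport_shift H S)"
    unfolding transport_shift_def
    using H(3) by (intro H.subshift_subshift_of_codings[OF _ clashes_subset])
      (simp add: finite_word_generating_def)
  note slices = free_extension_iff_slices[OF H(1) K(1) shift]

  \<comment> \<open>Chosen so that \<open>m * card D ^ 3 * \<epsilon> < 1\<close>, where \<open>card D ^ 3\<close> translates cover the boundary.\<close>
  let ?\<epsilon> = "1 / real (Suc (m * card D ^ 3))"
  let ?E = "(\<lambda>(d, d'). inv\<^bsub>H \<times>\<times> K\<^esub> d \<otimes>\<^bsub>H \<times>\<times> K\<^esub> d') ` (D \<times> D)"
  have \<epsilon>: "0 < ?\<epsilon>" by (simp del: of_nat_Suc)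
  have E: "finite ?E" "?E \<subseteq> carrier (H \<times>\<times> K)"
    using D by (auto simp: subset_iff simp del: carrier_DirProd mult_DirProd' inv_DirProd)
  obtain F F' where F: "finite F" "F \<noteq> {}" "F \<subseteq> carrier H"
    and F': "finite F'" "F' \<noteq> {}" "F' \<subseteq> carrier K"
    and small: "\<forall>s\<in>?E. real (card ((\<lambda>f. f \<otimes>\<^bsub>H \<times>\<times> K\<^esub> s) ` (F \<times> F') - F \<times> F'))
      \<le> ?\<epsilon> * real (card (F \<times> F'))"
    by (rule amenable_right_invariant_product[OF H(1,4) K(1,2) E \<epsilon>])
  let ?W = "F \<times> F'"
  have W: "finite ?W" "0 < card ?W" "?W \<subseteq> carrier (H \<times>\<times> K)"
    using F F' by (auto simp: card_gt_0_iff)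
  have "real (card (HK.boundary D ?W)) \<le> real (card D ^ 3) * (?\<epsilon> * real (card ?W))"
    using D W(1) by (intro HK.card_boundary_le small[rule_format]) auto
  then have "real (m * card (HK.boundary D ?W)) \<le> real m * (real (card D ^ 3) * (?\<epsilon> * real (card ?W)))"
    unfolding of_nat_mult[of m] by (rule mult_left_mono) simp
  also have "\<dots> = real (m * card D ^ 3) / real (Suc (m * card D ^ 3)) * real (card ?W)"
    by simp
  also have "\<dots> < 1 * real (card ?W)"
  proof (rule mult_strict_right_mono)
    show "real (m * card D ^ 3) / real (Suc (m * card D ^ 3)) < 1"
      by (subst divide_less_eq_1_pos) (simp_all del: of_nat_mult)
  qed (use W(2) in simp)
  finally have boundary: "m * card (HK.boundary D ?W) < card ?W" by linarith

  obtain a t where sep: "H.separates a t F" using H.ex_separates[OF H(2) F(1,3)] by blast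
  define y where "y = (\<lambda>Q. \<lambda>(h, k)\<in>carrier (H \<times>\<times> K). H.transported a t F {u. (u, k) \<in> Q} h)"
  have y_slice: "(\<lambda>h\<in>carrier H. y Q (h, k)) = H.transported a t F {u. (u, k) \<in> Q}"
    if "k \<in> carrier K" for Q k
    using that by (auto simp: y_def H.transported_def)
  have y_in: "y Q \<in> ?Y" for Q
  proof -
    have slice: "H.transported a t F R \<in> transport_shift H S" for R
      using sep F(3) S H(3) by (intro H.transported_in_transport_shift) (auto simp: H.separates_def)
    then have "H.transported a t F R h \<in> {..<5}" if "h \<in> carrier H" for R h
      using H.transport_shift_iff[OF H(3) S] that by (meson PiE_mem)
    then have "y Q \<in> configurations (H \<times>\<times> K) {..<5}" by (auto simp: y_def)
    then show ?thesis using slice unfolding slices by (simp add: y_slice)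
  qed
  have y_at: "y Q (h, k) = 1 \<longleftrightarrow> (h, k) \<in> Q" if "(h, k) \<in> ?W" for Q h k
  proof -
    have "h \<in> F" "h \<in> carrier H" "k \<in> carrier K" using that F(3) F'(3) by auto
    then show ?thesis using H.transported_on[OF sep] by (simp add: y_def)
  qed
  have inj: "inj_on y (Pow ?W)"
  proof (rule inj_onI)
    fix Q Q' assume "Q \<in> Pow ?W" "Q' \<in> Pow ?W" "y Q = y Q'"
    then show "Q = Q'" using y_at by (metis PowD subrelI subset_antisym subsetD)
  qed
  have exchanged: "override_on (y Q') (y Q) ?W \<notin> ?Y"
    if Q': "Q' \<subseteq> ?W" and uk: "(u, k) \<in> ?W" "(u, k) \<in> Q" "(u, k) \<notin> Q'" for Q Q' u k
  proof
    assume "override_on (y Q') (y Q) ?W \<in> ?Y"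
    moreover have k: "k \<in> carrier K" "k \<in> F'" using uk F'(3) by auto
    ultimately have "(\<lambda>h\<in>carrier H. override_on (y Q') (y Q) ?W (h, k)) \<in> transport_shift H S"
      unfolding slices by blast
    moreover have "(\<lambda>h\<in>carrier H. override_on (y Q') (y Q) ?W (h, k)) =
        override_on (H.transported a t F {u. (u, k) \<in> Q'}) (H.transported a t F {u. (u, k) \<in> Q}) F"
      using k F(3) by (auto simp: y_def override_on_def H.transported_def)
    ultimately show False
      using H.override_transported_notin[OF H(3) S sep F(3), of "{u. (u, k) \<in> Q'}" u "{u. (u, k) \<in> Q}"]
        Q' uk by auto
  qed
  have in_Y: "y ` Pow ?W \<subseteq> ?Y" using y_in by blast
  have "2 ^ (m * card (HK.boundary D ?W)) < card (y ` Pow ?W)"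
    using boundary W(1) by (simp add: card_image[OF inj] card_Pow)
  then obtain Q Q' where Q: "Q \<subseteq> ?W" "Q' \<subseteq> ?W" "y Q \<noteq> y Q'"
    and swapped: "override_on (y Q') (y Q) ?W \<in> ?Y" "override_on (y Q) (y Q') ?W \<in> ?Y"
    using exchange[rule_format, OF W(1,3) in_Y] by blast
  have "Q \<noteq> Q'" using Q(3) by auto
  then obtain w where "w \<in> ?W" "w \<in> Q \<and> w \<notin> Q' \<or> w \<in> Q' \<and> w \<notin> Q"
    using Q(1,2) by blast
  then show False
    using exchanged[OF Q(2), of "fst w" "snd w" Q] exchanged[OF Q(1), of "fst w" "snd w" Q'] swapped
    by auto
qed

theorem theorem1p1:
  fixes H :: "('h, 'm) monoid_scheme" and K :: "('k, 'n) monoid_scheme" and S :: "'h set"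
  assumes "group H" and "infinite (carrier H)" and "finite_word_generating H S" and "amenable H"
    and "group K" and "infinite (carrier K)" and "finitely_generated K" and "amenable K"
  shows "\<exists>(A :: nat set) (X :: ('h \<Rightarrow> nat) set).
           finite A \<and> subshift H A X \<and> effectively_closed_by_patterns H S A X \<and>
           \<not> sofic (H \<times>\<times> K) A (free_extension H K A X)"
proof (intro exI conjI)
  have S: "finite S" "S \<subseteq> carrier H" "S \<noteq> {}"
    using assms(2,3) by (auto simp: finite_word_generating_def dest: sym)
  show shift: "subshift H {..<5} (transport_shift H S)"
    unfolding transport_shift_def
    using group.subshift_subshift_of_codings[OF assms(1) S(2) clashes_subset] .
  show "effectively_closed_by_patterns H S {..<5} (transport_shift H S)"
    unfolding effectively_closed_by_patterns_def
    using shift clashes_subset recursively_enumerable_clashes[OF S(1,3)]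
    by (intro conjI exI[of _ "clashes S"]) (simp_all add: transport_shift_def)
  show "\<not> sofic (H \<times>\<times> K) {..<5} (free_extension H K {..<5} (transport_shift H S))"
    using free_extension_transport_shift_not_sofic assms by blast
qed simp

end
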